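(* Let $n\geq 1$ be an integer, let $q\geq 3$ be a prime power, and let $\mathcal{Q}^{+}(4n+1,q)$ be a hyperbolic quadric. Consider the following two types of sets of generators of $\mathcal{Q}^{+}(4n+1,q)$. (A) The set of all generators of one of the two generator classes. (B) For a generator $\pi$, the set consisting of $\pi$ together with all generators $\pi'$ of the generator class not containing $\pi$ such that $\pi'\cap\pi\neq\emptyset$. Then the two largest types of maximal Erdős-Ko-Rado sets of generators of $\mathcal{Q}^{+}(4n+1,q)$ are (A) and (B). That is: the sets of type (A) and of type (B) are maximal Erdős-Ko-Rado sets; every set of type (A) has strictly more elements than every set of type (B); and every maximal Erdős-Ko-Rado set of generators that is neither of type (A) nor of type (B) has strictly fewer elements than a set of type (B).
   Context: The hyperbolic quadric $\mathcal{Q}^{+}(2m+1,q)$ is the quadric in the projective space $\mathrm{PG}(2m+1,q)$ over the finite field $\mathbb{F}_q$ given, up to projective transformation, by the equation $X_0X_1+X_2X_3+\cdots+X_{2m}X_{2m+1}=0$. Its generators are the maximal (by inclusion) projective subspaces contained in it; they have projective dimension $m$. Projective dimension is used throughout, and the empty space has dimension $-1$. The relation $\pi\sim\pi'\Leftrightarrow\dim(\pi\cap\pi')\equiv m\pmod 2$ is an equivalence relation on the set of generators with exactly two equivalence classes, of the same size, called the two generator classes. Here $m=2n$. An Erdős-Ko-Rado set of generators of a hyperbolic quadric is a set of generators such that any two of its elements have a nonempty intersection (share at least one projective point). It is maximal if it is not properly contained in another Erdős-Ko-Rado set of generators of the same quadric. *)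

theory Defs
  imports "HOL-Analysis.Cartesian_Space"
begin

text \<open>
  A projective subspace of PG(d-1,q) is represented by the corresponding linear subspace of the
  d-dimensional coordinate space over the field \<open>'a\<close> with q elements, where d is \<open>CARD('d)\<close>.
  The empty projective space is thus the linear subspace \<open>{0}\<close>, and two projective subspaces
  always share the zero vector: disjointness has to be read off from their points.
\<close>

definition proj_dim :: "('a::field ^ 'd) set \<Rightarrow> int" where
  "proj_dim U = int (vec.dim U) - 1"

definition points_of :: "('a::field ^ 'd) set \<Rightarrow> ('a ^ 'd) set set" where
  "points_of U = {P. vec.subspace P \<and> proj_dim P = 0 \<and> P \<subseteq> U}"

definition meets :: "('a::field ^ 'd) set \<Rightarrow> ('a ^ 'd) set \<Rightarrow> bool" where
  "meets U W \<longleftrightarrow> points_of (U \<inter> W) \<noteq> {}"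

text \<open>
  A quadric is a set of points.  The bijection \<open>e\<close> numbers the coordinates by 0, ..., 2m+1 (and
  forces \<open>CARD('d) = 2 * m + 2\<close>); the invertible matrix \<open>M\<close> is the projective transformation.
  Semilinear transformations would give nothing new, as the equation has coefficients in the
  prime field.
\<close>

definition hyperbolic_quadric :: "nat \<Rightarrow> ('a::field ^ 'd) set set \<Rightarrow> bool" where
  "hyperbolic_quadric m Q \<longleftrightarrow>
     (\<exists>(M :: 'a ^ 'd ^ 'd) (e :: nat \<Rightarrow> 'd). invertible M \<and> bij_betw e {..<2 * m + 2} UNIV \<and>
        Q = {P \<in> points_of UNIV.
               \<forall>x\<in>P. (\<Sum>i\<le>m. (M *v x) $ e (2 * i) * (M *v x) $ e (2 * i + 1)) = 0})"

definition subspaces_on :: "('a::field ^ 'd) set set \<Rightarrow> ('a ^ 'd) set set" where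
  "subspaces_on Q = {U. vec.subspace U \<and> points_of U \<subseteq> Q}"

definition generators :: "('a::field ^ 'd) set set \<Rightarrow> ('a ^ 'd) set set" where
  "generators Q = {U \<in> subspaces_on Q. \<forall>W\<in>subspaces_on Q. U \<subseteq> W \<longrightarrow> W = U}"

definition generator_rel :: "nat \<Rightarrow> ('a::field ^ 'd) set set \<Rightarrow> (('a ^ 'd) set \<times> ('a ^ 'd) set) set" where
  "generator_rel m Q = {(U, W). U \<in> generators Q \<and> W \<in> generators Q \<and>
                          proj_dim (U \<inter> W) mod 2 = int m mod 2}"

definition generator_classes :: "nat \<Rightarrow> ('a::field ^ 'd) set set \<Rightarrow> ('a ^ 'd) set set set" where
  "generator_classes m Q = generators Q // generator_rel m Q"

definition EKR_set :: "('a::field ^ 'd) set set \<Rightarrow> ('a ^ 'd) set set \<Rightarrow> bool" where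
  "EKR_set Q S \<longleftrightarrow> S \<subseteq> generators Q \<and> (\<forall>U\<in>S. \<forall>W\<in>S. meets U W)"

definition maximal_EKR_set :: "('a::field ^ 'd) set set \<Rightarrow> ('a ^ 'd) set set \<Rightarrow> bool" where
  "maximal_EKR_set Q S \<longleftrightarrow> EKR_set Q S \<and> \<not> (\<exists>T. EKR_set Q T \<and> S \<subset> T)"

definition EKR_type_A :: "nat \<Rightarrow> ('a::field ^ 'd) set set \<Rightarrow> ('a ^ 'd) set set set" where
  "EKR_type_A m Q = generator_classes m Q"

text \<open>
  There are exactly two generator classes, so \<open>C\<close> below ranges over the single class that does
  not contain \<open>U\<close>.
\<close>

definition EKR_type_B :: "nat \<Rightarrow> ('a::field ^ 'd) set set \<Rightarrow> ('a ^ 'd) set set set" where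
  "EKR_type_B m Q =
     {insert U {W. \<exists>C\<in>generator_classes m Q. U \<notin> C \<and> W \<in> C \<and> meets W U} | U. U \<in> generators Q}"

end

theory Submission
  imports Defs
begin

text \<open>
  Let \<open>N = 2n + 1\<close> be the vector dimension of a generator. Generators of one class meet in odd
  dimension, hence never trivially, so an Erdos-Ko-Rado set is an independent set of the bipartite
  graph of disjointness between the two classes. By transitivity of the isometry group (already of
  the reflections) this graph is regular, say of degree \<open>D\<close>, with \<open>K\<close> generators in each class;
  a set of type B has \<open>K - D + 1\<close> elements.

  Two distinct generators of one class have at least \<open>D + D/q\<close> neighbours altogether. Hence, if an
  independent set has \<open>a \<ge> 2\<close> elements in one class and \<open>b \<ge> 2\<close> in the other, then both \<open>a\<close> and
  \<open>b\<close> are at most \<open>K - D - D/q\<close>. Counting pairs of a point of a fixed generator and a generator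
  of the other class through it gives \<open>K \<le> D + 2D/q\<close> for \<open>q \<ge> 3\<close>, and so \<open>a + b \<le> K - D\<close>.
\<close>

section \<open>Linear algebra: kernels of functionals and cardinalities of subspaces over a finite
  field\<close>

lemma vec_dim_le_dim_kernel:
  fixes f :: "'a::field ^ 'd \<Rightarrow> 'a"
  assumes S: "vec.subspace S"
    and add: "\<And>x y. f (x + y) = f x + f y" and scale: "\<And>c x. f (c *s x) = c * f x"
  shows "vec.dim S \<le> vec.dim (S \<inter> {x. f x = 0}) + 1"
proof (cases "S \<subseteq> {x. f x = 0}")
  case True
  then show ?thesis by (simp add: Int_absorb2)
next
  case False
  then obtain z where z: "z \<in> S" "f z \<noteq> 0" by auto
  let ?K = "S \<inter> {x. f x = 0}"
  have "S \<subseteq> vec.span (insert z ?K)"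
  proof
    fix x assume x: "x \<in> S"
    let ?c = "f x / f z"
    have "x + (- ?c) *s z \<in> S" using S x z by (intro vec.subspace_add vec.subspace_scale)
    moreover have "f (x + (- ?c) *s z) = 0" using z by (simp only: add scale) simp
    ultimately have "x - ?c *s z \<in> vec.span ?K" by (intro vec.span_base) simp
    then show "x \<in> vec.span (insert z ?K)" by (auto simp: vec.span_insert)
  qed
  then have "vec.dim S \<le> vec.dim (insert z ?K)" by (rule vec.dim_mono)
  also have "\<dots> \<le> vec.dim ?K + 1" by (simp add: vec.dim_insert)
  finally show ?thesis .
qed

lemma card_vec_span_independent:
  fixes B :: "('a::{field,finite} ^ 'd) set"
  assumes "vec.independent B"
  shows "card (vec.span B) = CARD('a) ^ card B"
  using vec.finiteI_independent[OF assms] assms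
proof (induction B)
  case empty
  then show ?case by simp
next
  case (insert b B)
  have ind: "vec.independent B" using insert.prems vec.independent_mono by blast
  have b: "b \<notin> vec.span B" using insert by (simp add: vec.independent_insert)
  have eq: "vec.span (insert b B) = (\<lambda>(c, y). y + c *s b) ` (UNIV \<times> vec.span B)"
  proof safe
    fix x assume "x \<in> vec.span (insert b B)"
    then obtain c where "x - c *s b \<in> vec.span B" by (auto simp: vec.span_insert)
    then show "x \<in> (\<lambda>(c, y). y + c *s b) ` (UNIV \<times> vec.span B)"
      by (intro image_eqI[of _ _ "(c, x - c *s b)"]) auto
  next
    fix c y assume "y \<in> vec.span B"
    then show "y + c *s b \<in> vec.span (insert b B)"
      by (auto simp: vec.span_insert intro: exI[of _ c])
  qed
  have "inj_on (\<lambda>(c, y). y + c *s b) (UNIV \<times> vec.span B)"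
  proof (rule inj_onI, clarsimp)
    fix c y c' y' assume y: "y \<in> vec.span B" "y' \<in> vec.span B" and e: "y + c *s b = y' + c' *s b"
    have "(c - c') *s b = y' - y" using e by (simp add: vec.scale_left_diff_distrib algebra_simps)
    then have m: "(c - c') *s b \<in> vec.span B" using y by (simp add: vec.span_diff)
    have "c = c'"
    proof (rule ccontr)
      assume "c \<noteq> c'"
      then have "inverse (c - c') *s ((c - c') *s b) = b" by simp
      then show False using b vec.span_scale[OF m] by metis
    qed
    then show "c = c' \<and> y = y'" using e by simp
  qed
  then have "card (vec.span (insert b B)) = CARD('a) * card (vec.span B)"
    by (simp add: eq card_image card_cartesian_product)
  then show ?case using insert ind by simp
qed

lemma card_vec_subspace:
  fixes S :: "('a::{field,finite} ^ 'd) set"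
  assumes "vec.subspace S"
  shows "card S = CARD('a) ^ vec.dim S"
proof -
  obtain B where "B \<subseteq> S" "vec.independent B" "S \<subseteq> vec.span B" "card B = vec.dim S"
    using vec.basis_exists by metis
  moreover then have "vec.span B = S" using assms vec.span_minimal by blast
  ultimately show ?thesis using card_vec_span_independent by metis
qed

lemma vec_subspace_nonzero:
  assumes "vec.subspace S"
  shows "S = {0} \<longleftrightarrow> (\<forall>x\<in>S. x = 0)"
  using vec.subspace_0[OF assms] by auto

section \<open>Hyperbolic quadratic forms, perps and totally singular subspaces\<close>

text \<open>\<open>B\<close> is the polar form of the quadratic form \<open>F\<close>. Keeping
  \<open>F\<close> primary covers characteristic 2 as well, where \<open>B\<close> does not
  determine \<open>F\<close>. The last assumption makes the form hyperbolic.\<close>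

locale hyperbolic_form =
  fixes F :: "'a::{field,finite} ^ 'd \<Rightarrow> 'a" and B :: "'a ^ 'd \<Rightarrow> 'a ^ 'd \<Rightarrow> 'a" and N :: nat
  assumes card_index: "CARD('d) = 2 * N"
    and F_add: "F (x + y) = F x + F y + B x y"
    and F_scale: "F (c *s x) = c * c * F x"
    and B_add_left: "B (x + y) z = B x z + B y z"
    and B_scale_left: "B (c *s x) z = c * B x z"
    and B_nondegenerate: "(\<And>y. B x y = 0) \<Longrightarrow> x = 0"
    and ex_singular_subspace: "\<exists>U. vec.subspace U \<and> (\<forall>x\<in>U. F x = 0) \<and> vec.dim U = N"
begin

lemma B_sym: "B x y = B y x"
  using F_add[of x y] F_add[of y x] by (simp add: add.commute)

lemma B_add_right: "B x (y + z) = B x y + B x z"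
  using B_add_left B_sym by metis

lemma B_scale_right: "B x (c *s y) = c * B x y"
  using B_scale_left B_sym by metis

lemma F_zero [simp]: "F 0 = 0"
  using F_scale[of 0 0] by simp

lemma B_zero_left [simp]: "B 0 y = 0"
  using B_scale_left[of 0 0 y] by simp

lemma B_zero_right [simp]: "B x 0 = 0"
  using B_zero_left B_sym by metis

lemma B_minus_left [simp]: "B (- x) y = - B x y"
  using B_scale_left[of "-1" x y] by simp

lemma B_minus_right [simp]: "B x (- y) = - B x y"
  using B_minus_left B_sym by metis

lemma F_minus [simp]: "F (- x) = F x"
  using F_scale[of "-1" x] by simp

lemma B_diff_left: "B (x - y) z = B x z - B y z"
  using B_add_left[of x "- y" z] by simp

lemma B_diff_right: "B x (y - z) = B x y - B x z"
  using B_add_right[of x y "- z"] by simp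

lemma F_diff: "F (x - y) = F x + F y - B x y"
  using F_add[of x "- y"] by simp

lemma B_self: "B x x = F x + F x"
proof -
  have "F (x + x) = F ((1 + 1) *s x)" by (simp only: vec.scale_left_distrib vec.scale_one)
  also have "\<dots> = (1 + 1) * (1 + 1) * F x" by (rule F_scale)
  finally show ?thesis using F_add[of x x] by (simp add: algebra_simps)
qed

lemmas B_linear = B_add_left B_add_right B_scale_left B_scale_right B_diff_left B_diff_right

definition perp :: "('a ^ 'd) set \<Rightarrow> ('a ^ 'd) set" where
  "perp A = {x. \<forall>y\<in>A. B x y = 0}"

lemma subspace_perp: "vec.subspace (perp A)"
  by (auto simp: perp_def vec.subspace_def B_linear)

lemma perp_span: "perp (vec.span A) = perp A"
proof -
  have "B x y = 0" if "\<forall>z\<in>A. B x z = 0" "y \<in> vec.span A" for x y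
    using that(2)
    by (induction rule: vec.span_induct_alt) (auto simp: B_linear that(1))
  then show ?thesis by (auto simp: perp_def vec.span_base)
qed

lemma dim_le_dim_Int_perp:
  assumes "finite A" "vec.subspace S"
  shows "vec.dim S \<le> vec.dim (S \<inter> perp A) + card A"
  using assms
proof (induction A)
  case empty
  then show ?case by (simp add: perp_def)
next
  case (insert a A)
  have "vec.dim (S \<inter> perp A) \<le> vec.dim ((S \<inter> perp A) \<inter> {x. B x a = 0}) + 1"
    by (rule vec_dim_le_dim_kernel)
      (auto simp: B_linear intro: vec.subspace_inter subspace_perp insert)
  moreover have "(S \<inter> perp A) \<inter> {x. B x a = 0} = S \<inter> perp (insert a A)"
    by (auto simp: perp_def)
  ultimately show ?case using insert by simp
qed

text \<open>Each basis vector of \<open>W\<close> costs at most one dimension, which bounds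
  \<open>perp W\<close> from below. For the upper bound the basis \<open>A\<close> of
  \<open>W\<close> is extended to a basis \<open>C\<close> of the space: the
  \<open>card (C - A)\<close> further conditions cut \<open>perp A\<close> down to
  \<open>{0}\<close> by nondegeneracy.\<close>

lemma dim_perp:
  assumes W: "vec.subspace W"
  shows "vec.dim (perp W) + vec.dim W = 2 * N"
proof -
  obtain A where A: "A \<subseteq> W" "vec.independent A" "W \<subseteq> vec.span A" "card A = vec.dim W"
    using vec.basis_exists by metis
  have span: "vec.span A = W" using A W vec.span_minimal by blast
  have full: "vec.dim (UNIV :: ('a ^ 'd) set) = 2 * N" by (simp only: vec_dim_card card_index)
  obtain C where C: "A \<subseteq> C" "vec.independent C" "UNIV \<subseteq> vec.span C"
    using vec.maximal_independent_subset_extend[of A UNIV] A by auto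
  have fin: "finite A" "finite C" using A C vec.finiteI_independent by auto
  have "card C = 2 * N"
    using C full vec.dim_eq_card_independent[of C] vec.dim_span[of C] by (simp add: top.extremum_unique)
  then have card: "card (C - A) + vec.dim W = 2 * N"
    using C A fin card_mono[OF fin(2) C(1)] by (simp add: card_Diff_subset)
  have "2 * N \<le> vec.dim (perp W) + vec.dim W"
    using dim_le_dim_Int_perp[OF fin(1), of UNIV] full A by (simp flip: span add: perp_span)
  moreover have "vec.dim (perp W) + vec.dim W \<le> 2 * N"
  proof -
    have "perp A \<inter> perp (C - A) = perp (vec.span C)"
      unfolding perp_span using C by (auto simp: perp_def)
    also have "\<dots> \<subseteq> {0}"
    proof
      fix x assume "x \<in> perp (vec.span C)"
      then have "B x y = 0" for y using C(3) by (auto simp: perp_def)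
      then show "x \<in> {0}" using B_nondegenerate by simp
    qed
    finally have "vec.dim (perp A \<inter> perp (C - A)) = 0" by simp
    then have "vec.dim (perp A) \<le> card (C - A)"
      using dim_le_dim_Int_perp[OF finite_Diff[OF fin(2)] subspace_perp, of A A] by linarith
    then show ?thesis using card by (simp flip: span add: perp_span)
  qed
  ultimately show ?thesis by simp
qed

text \<open>Fixing the dimension instead of asking for maximality suits the counting;
  \<open>generators_iff\<close> shows that the two notions agree.\<close>

definition gen :: "('a ^ 'd) set \<Rightarrow> bool" where
  "gen U \<longleftrightarrow> vec.subspace U \<and> (\<forall>x\<in>U. F x = 0) \<and> vec.dim U = N"

lemma
  assumes "gen U"
  shows gen_subspace: "vec.subspace U" and gen_singular: "x \<in> U \<Longrightarrow> F x = 0"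
    and gen_dim: "vec.dim U = N"
  using assms by (auto simp: gen_def)

lemma singular_subspace_B:
  assumes "vec.subspace U" "\<forall>x\<in>U. F x = 0" "x \<in> U" "y \<in> U"
  shows "B x y = 0"
  using assms vec.subspace_add[of U x y] F_add[of x y] by auto

lemma perp_gen:
  assumes "gen U"
  shows "perp U = U"
proof -
  have "U \<subseteq> perp U" using assms singular_subspace_B by (auto simp: perp_def gen_def)
  then show ?thesis
    using vec.subspace_dim_equal[of U "perp U"] dim_perp[of U] assms subspace_perp
    by (auto simp: gen_def)
qed

lemma gen_B: "gen U \<Longrightarrow> x \<in> U \<Longrightarrow> y \<in> U \<Longrightarrow> B x y = 0"
  using perp_gen by (auto simp: perp_def)

lemma notin_gen: "gen U \<Longrightarrow> x \<notin> U \<Longrightarrow> \<exists>y\<in>U. B x y \<noteq> 0"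
  using perp_gen by (auto simp: perp_def)

text \<open>Since \<open>perp U = U\<close>, the perp of the sum of \<open>U\<close> and
  \<open>T\<close> is \<open>U \<inter> perp T\<close>; the formula combines \<open>dim_perp\<close>
  with the dimension of a sum.\<close>

lemma dim_gen_Int_perp:
  assumes U: "gen U" and T: "vec.subspace T"
  shows "vec.dim (U \<inter> perp T) + vec.dim T = N + vec.dim (U \<inter> T)"
proof -
  let ?S = "{x + y | x y. x \<in> U \<and> y \<in> T}"
  have sub: "vec.subspace ?S" using vec.subspace_sums U T gen_subspace by blast
  have "perp ?S = U \<inter> perp T"
  proof -
    have "0 \<in> T" "0 \<in> U" using U T by (auto simp: vec.subspace_0 gen_subspace)
    then have "perp ?S = perp U \<inter> perp T"
      apply (auto simp: perp_def B_linear)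
      apply (metis add.right_neutral B_zero_right)
      by (metis add.left_neutral)
    then show ?thesis using perp_gen U by simp
  qed
  then show ?thesis
    using dim_perp[OF sub] vec.dim_sums_Int[of U T] U T by (simp add: gen_def)
qed

text \<open>For any generator \<open>G\<close>, the sum of \<open>G \<inter> perp U\<close> and
  \<open>U\<close> is totally singular, and it has dimension \<open>N\<close> by
  \<open>dim_gen_Int_perp\<close>.\<close>

lemma ex_gen_superset:
  assumes U: "vec.subspace U" "\<forall>x\<in>U. F x = 0"
  shows "\<exists>G. gen G \<and> U \<subseteq> G"
proof -
  obtain G where G: "gen G" using ex_singular_subspace by (auto simp: gen_def)
  let ?P = "G \<inter> perp U"
  let ?S = "{x + y | x y. x \<in> ?P \<and> y \<in> U}"
  have P: "vec.subspace ?P" using G subspace_perp by (simp add: vec.subspace_inter gen_subspace)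
  have S: "vec.subspace ?S" using vec.subspace_sums P U by blast
  have "U \<subseteq> perp U" using U singular_subspace_B by (auto simp: perp_def)
  then have "?P \<inter> U = G \<inter> U" by auto
  then have "vec.dim ?S = N"
    using vec.dim_sums_Int[OF P U(1)] dim_gen_Int_perp[OF G U(1)] by simp
  moreover have "\<forall>x\<in>?S. F x = 0"
    using G U by (auto simp: F_add gen_singular perp_def)
  moreover have "U \<subseteq> ?S" using vec.subspace_0[OF P] by force
  ultimately show ?thesis using S by (auto simp: gen_def)
qed

subsection \<open>Reflections and the parity of intersections\<close>

definition isometry :: "('a ^ 'd \<Rightarrow> 'a ^ 'd) \<Rightarrow> bool" where
  "isometry g \<longleftrightarrow> (\<forall>x y. g (x + y) = g x + g y) \<and> (\<forall>c x. g (c *s x) = c *s g x) \<and>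
     (\<forall>x. F (g x) = F x)"

lemma isometry_B: "isometry g \<Longrightarrow> B (g x) (g y) = B x y"
  using F_add[of x y] F_add[of "g x" "g y"] by (metis isometry_def add_left_cancel)

lemma isometry_linear: "isometry g \<Longrightarrow> Vector_Spaces.linear (*s) (*s) g"
  by (auto simp: isometry_def Vector_Spaces.linear_iff vec.vector_space_axioms)

lemma isometry_inj:
  assumes g: "isometry g"
  shows "inj g"
proof (rule injI)
  fix x y assume e: "g x = g y"
  have "B (x - y) z = 0" for z
    using isometry_B[OF g, of x z] isometry_B[OF g, of y z] e by (simp add: B_diff_left)
  then show "x = y" using B_nondegenerate[of "x - y"] by simp
qed

lemma isometry_subspace:
  assumes "isometry g" "vec.subspace U"
  shows "vec.subspace (g ` U)" "vec.dim (g ` U) = vec.dim U"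
proof -
  show "vec.subspace (g ` U)"
    using assms isometry_linear vec.linear_subspace_image by blast
  show "vec.dim (g ` U) = vec.dim U"
    using assms isometry_linear isometry_inj vec.dim_image_eq by (metis inj_on_subset subset_UNIV)
qed

lemma isometry_gen: "isometry g \<Longrightarrow> gen U \<Longrightarrow> gen (g ` U)"
  using isometry_subspace[of g U] by (auto simp: gen_def isometry_def)

lemma isometry_dim_Int:
  assumes "isometry g" "gen U" "gen W"
  shows "vec.dim (g ` U \<inter> g ` W) = vec.dim (U \<inter> W)"
  using isometry_subspace(2)[of g "U \<inter> W"] assms isometry_inj[of g]
  by (simp add: image_Int gen_subspace vec.subspace_inter)

lemma isometry_comp: "isometry g \<Longrightarrow> isometry h \<Longrightarrow> isometry (g \<circ> h)"
  by (simp add: isometry_def)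

text \<open>As \<open>B r r = 2 * F r\<close>, this is the usual reflection in odd characteristic;
  dividing by \<open>F r\<close> gives the orthogonal transvection in characteristic 2.\<close>

definition reflect :: "'a ^ 'd \<Rightarrow> 'a ^ 'd \<Rightarrow> 'a ^ 'd" where
  "reflect r x = x - (B x r / F r) *s r"

lemma reflect_isometry:
  assumes "F r \<noteq> 0"
  shows "isometry (reflect r)"
  unfolding isometry_def
proof (intro conjI allI)
  fix x y c
  show "reflect r (x + y) = reflect r x + reflect r y"
    by (simp add: reflect_def B_linear add_divide_distrib vec.scale_left_distrib)
  show "reflect r (c *s x) = c *s reflect r x"
    by (simp add: reflect_def B_linear vec.scale_right_diff_distrib)
  show "F (reflect r x) = F x"
    using assms by (simp add: reflect_def F_diff F_scale B_linear)
qed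

lemma reflect_reflect:
  assumes "F r \<noteq> 0"
  shows "reflect r (reflect r x) = x"
proof -
  have "B (reflect r x) r = - B x r"
    using assms by (simp add: reflect_def B_linear B_self field_simps)
  then show ?thesis by (simp add: reflect_def[of r "reflect r x"]) (simp add: reflect_def)
qed

lemma reflect_fixed: "B x r = 0 \<Longrightarrow> reflect r x = x"
  by (simp add: reflect_def)

lemma in_reflect_image: "F r \<noteq> 0 \<Longrightarrow> x \<in> reflect r ` U \<longleftrightarrow> reflect r x \<in> U"
  using reflect_reflect by (metis image_iff)

lemma gen_Int_reflect:
  assumes r: "F r \<noteq> 0" and U: "gen U"
  shows "U \<inter> reflect r ` U = U \<inter> perp {r}"
proof -
  have "B x r = 0" if x: "x \<in> U" "reflect r x \<in> U" for x
  proof (rule ccontr)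
    assume n: "B x r \<noteq> 0"
    \<comment> \<open>This multiple of \<open>x - reflect r x\<close> is \<open>r\<close> itself,
      which is nonsingular and so cannot lie in \<open>U\<close>.\<close>
    have "(F r / B x r) *s (x - reflect r x) \<in> U"
      using x U by (intro vec.subspace_scale vec.subspace_diff gen_subspace)
    then have "r \<in> U" using r n by (simp add: reflect_def)
    then show False using r U gen_singular by blast
  qed
  then show ?thesis using r reflect_fixed by (auto simp: perp_def in_reflect_image)
qed

lemma dim_gen_Int_reflect:
  assumes r: "F r \<noteq> 0" and U: "gen U"
  shows "vec.dim (U \<inter> reflect r ` U) + 1 = N"
proof -
  have "r \<noteq> 0" using r by auto
  have "vec.span {r} \<inter> U \<subseteq> {0}"
  proof
    fix x assume x: "x \<in> vec.span {r} \<inter> U"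
    then obtain c where "x = c *s r" by (auto simp: vec.span_singleton)
    moreover then have "F x = c * c * F r" by (simp add: F_scale)
    ultimately show "x \<in> {0}" using gen_singular[OF U] x r by auto
  qed
  then have "vec.dim (U \<inter> vec.span {r}) = 0" by (subst Int_commute) simp
  then show ?thesis
    using dim_gen_Int_perp[OF U, of "vec.span {r}"] gen_Int_reflect[OF r U] \<open>r \<noteq> 0\<close>
    by (simp add: perp_span)
qed

text \<open>With \<open>s = reflect r\<close>, the singular vectors of \<open>(U \<inter> sU)\<^sup>\<bottom> = U + \<langle>r\<rangle>\<close> are those of \<open>U \<union> sU\<close>, and a subspace
  covered by two subspaces lies in one of them.\<close>

lemma gen_Int_reflect_cases:
  assumes r: "F r \<noteq> 0" and U: "gen U" and W: "gen W"
  shows "(W \<inter> reflect r ` U \<subseteq> W \<inter> U \<and> vec.dim (W \<inter> U) = vec.dim (W \<inter> reflect r ` U) + 1) \<or>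
         (W \<inter> U \<subseteq> W \<inter> reflect r ` U \<and> vec.dim (W \<inter> reflect r ` U) = vec.dim (W \<inter> U) + 1)"
proof -
  let ?U' = "reflect r ` U"
  let ?H = "U \<inter> ?U'"
  let ?S = "{x + y | x y. x \<in> U \<and> y \<in> vec.span {r}}"
  have U': "gen ?U'" using isometry_gen reflect_isometry r U by blast
  have subs: "vec.subspace U" "vec.subspace ?U'" "vec.subspace W"
    using U U' W gen_subspace by auto
  have H: "vec.subspace ?H" using subs vec.subspace_inter by blast
  have "r \<noteq> 0" "r \<notin> U" using r gen_singular[OF U] by auto
  have S: "vec.subspace ?S" using subs by (intro vec.subspace_sums) auto
  have "perp ?H = ?S"
  proof (rule sym, rule vec.subspace_dim_equal[OF S subspace_perp])
    show "?S \<subseteq> perp ?H"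
      using gen_B[OF U] B_sym
      by (auto simp: gen_Int_reflect[OF r U] perp_def vec.span_singleton B_linear)
    have "U \<inter> vec.span {r} \<subseteq> {0}"
    proof
      fix x assume x: "x \<in> U \<inter> vec.span {r}"
      then obtain c where "x = c *s r" by (auto simp: vec.span_singleton)
      moreover then have "F x = c * c * F r" by (simp add: F_scale)
      ultimately show "x \<in> {0}" using gen_singular[OF U] x r by auto
    qed
    then have "vec.dim (U \<inter> vec.span {r}) = 0" by simp
    then have "vec.dim ?S = N + 1"
      using vec.dim_sums_Int[OF subs(1), of "vec.span {r}"] \<open>r \<noteq> 0\<close> gen_dim[OF U]
      by (simp del: vec.dim_eq_0)
    then show "vec.dim (perp ?H) \<le> vec.dim ?S"
      using dim_perp[OF H] dim_gen_Int_reflect[OF r U] by simp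
  qed
  have cover: "W \<inter> perp ?H = (W \<inter> U) \<union> (W \<inter> ?U')"
  proof (rule antisym)
    show "(W \<inter> U) \<union> (W \<inter> ?U') \<subseteq> W \<inter> perp ?H"
      using gen_B[OF U] gen_B[OF U'] by (fastforce simp: perp_def)
    show "W \<inter> perp ?H \<subseteq> (W \<inter> U) \<union> (W \<inter> ?U')"
    proof
      fix x assume x: "x \<in> W \<inter> perp ?H"
      then obtain u c where u: "u \<in> U" and xe: "x = u + c *s r"
        using \<open>perp ?H = ?S\<close> by (auto simp: vec.span_singleton)
      have "F x = 0" using x gen_singular[OF W] by simp
      \<comment> \<open>On \<open>u + c *s r\<close> the form factors. A zero first factor puts
        \<open>x\<close> in \<open>U\<close>; a zero second factor makes \<open>u\<close> the
        reflection of \<open>x\<close>.\<close>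
      then have "c * (B u r + c * F r) = 0"
        using gen_singular[OF U u] by (simp add: xe F_add F_scale B_linear algebra_simps)
      then consider "c = 0" | "B u r = - (c * F r)"
        by (metis add.inverse_unique mult_eq_0_iff add.commute minus_unique)
      then show "x \<in> (W \<inter> U) \<union> (W \<inter> ?U')"
      proof cases
        case 1
        then show ?thesis using x u xe by simp
      next
        case 2
        then have "B x r = c * F r" by (simp add: xe B_linear B_self algebra_simps)
        then have "reflect r x = u" using r by (simp add: reflect_def xe)
        then show ?thesis using x u r in_reflect_image by auto
      qed
    qed
  qed
  have dim: "vec.dim (W \<inter> perp ?H) = vec.dim (W \<inter> ?H) + 1"
    using dim_gen_Int_perp[OF W H] dim_gen_Int_reflect[OF r U] by simp
  have "W \<inter> U \<subseteq> W \<inter> ?U' \<or> W \<inter> ?U' \<subseteq> W \<inter> U"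
  proof (rule ccontr)
    assume "\<not> ?thesis"
    then obtain x y where xy: "x \<in> W" "x \<in> U" "x \<notin> ?U'" "y \<in> W" "y \<in> ?U'" "y \<notin> U" by auto
    have "x + y \<in> W \<inter> perp ?H"
      unfolding cover[symmetric] using cover xy subs subspace_perp
      by (metis IntI UnCI vec.subspace_add vec.subspace_inter)
    then have "x + y \<in> U \<or> x + y \<in> ?U'" using cover by auto
    moreover have "(x + y) - x = y" "(x + y) - y = x" by simp_all
    ultimately show False using xy subs vec.subspace_diff by metis
  qed
  then show ?thesis
  proof
    assume s: "W \<inter> U \<subseteq> W \<inter> ?U'"
    then have "W \<inter> ?H = W \<inter> U" "W \<inter> perp ?H = W \<inter> ?U'" using cover by auto
    then show ?thesis using dim s by simp
  next
    assume s: "W \<inter> ?U' \<subseteq> W \<inter> U"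
    then have "W \<inter> ?H = W \<inter> ?U'" "W \<inter> perp ?H = W \<inter> U" using cover by auto
    then show ?thesis using dim s by simp
  qed
qed

lemma even_dim_Int_reflect:
  assumes "F r \<noteq> 0" "gen U" "gen W"
  shows "even (vec.dim (W \<inter> reflect r ` U)) \<longleftrightarrow> odd (vec.dim (W \<inter> U))"
  using gen_Int_reflect_cases[OF assms] by auto

text \<open>Both \<open>F (x - y)\<close> and \<open>B x (x - y)\<close> equal
  \<open>- B x y\<close>, so the reflection subtracts exactly \<open>x - y\<close> from
  \<open>x\<close>.\<close>

lemma reflect_to:
  assumes "F x = 0" "F y = 0" "B x y \<noteq> 0"
  shows "F (x - y) \<noteq> 0" "reflect (x - y) x = y"
proof -
  show "F (x - y) \<noteq> 0" using assms by (simp add: F_diff)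
  have "B x (x - y) / F (x - y) = 1"
    using assms by (simp add: F_diff B_linear B_self)
  then show "reflect (x - y) x = y" by (simp add: reflect_def)
qed

text \<open>A reflection taking some \<open>a\<close> in \<open>U\<close> to a vector
  \<open>x\<close> of \<open>W\<close> outside \<open>U\<close> brings \<open>x\<close> into the
  intersection, which excludes the decreasing case of \<open>gen_Int_reflect_cases\<close>.\<close>

lemma gen_step:
  assumes U: "gen U" and W: "gen W" and ne: "U \<noteq> W"
  shows "\<exists>r. F r \<noteq> 0 \<and> vec.dim (reflect r ` U \<inter> W) = vec.dim (U \<inter> W) + 1"
proof -
  have "\<not> W \<subseteq> U"
    using vec.subspace_dim_equal[of W U] U W ne by (auto simp: gen_def)
  then obtain x where x: "x \<in> W" "x \<notin> U" by auto
  then obtain a where a: "a \<in> U" "B x a \<noteq> 0" using notin_gen[OF U] by blast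
  let ?r = "a - x"
  have r: "F ?r \<noteq> 0" "reflect ?r a = x"
    using reflect_to[of a x] a x gen_singular U W B_sym by metis+
  have "x \<in> reflect ?r ` U" using r(2) a(1) by (metis imageI)
  then have "\<not> (W \<inter> reflect ?r ` U \<subseteq> W \<inter> U)" using x by auto
  then show ?thesis using gen_Int_reflect_cases[OF r(1) U W] r(1) by (auto simp: Int_commute)
qed

text \<open>\<open>V\<close> is moved to \<open>W\<close> by the reflections of
  \<open>gen_step\<close>. Each flips the parity of two of the three summands, and for
  \<open>V = W\<close> the sum is \<open>N\<close> plus an even number. For odd \<open>N\<close>,
  meeting in odd dimension is therefore an equivalence relation with at most two classes.\<close>

lemma gen_parity:
  assumes "gen U" "gen V" "gen W"
  shows "even (vec.dim (U \<inter> V) + vec.dim (V \<inter> W) + vec.dim (U \<inter> W)) \<longleftrightarrow> even N"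
  using assms
proof (induction "N - vec.dim (V \<inter> W)" arbitrary: V rule: less_induct)
  case less
  show ?case
  proof (cases "V = W")
    case True
    then show ?thesis using gen_dim[OF less.prems(3)] by auto
  next
    case False
    then obtain r where r: "F r \<noteq> 0" "vec.dim (reflect r ` V \<inter> W) = vec.dim (V \<inter> W) + 1"
      using gen_step less by blast
    have V': "gen (reflect r ` V)" using r less isometry_gen reflect_isometry by blast
    have "vec.dim (reflect r ` V \<inter> W) \<le> N"
      using vec.dim_subset[of "reflect r ` V \<inter> W" W] gen_dim[OF less.prems(3)] by simp
    then have "N - vec.dim (reflect r ` V \<inter> W) < N - vec.dim (V \<inter> W)" using r by simp
    from less.hyps[OF this less.prems(1) V' less.prems(3)]
    show ?thesis
      using r even_dim_Int_reflect[OF r(1) less.prems(2,1)] by auto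
  qed
qed

lemma gen_transitive:
  assumes "gen V" "gen W"
  shows "\<exists>g. isometry g \<and> g ` V = W"
  using assms
proof (induction "N - vec.dim (V \<inter> W)" arbitrary: V rule: less_induct)
  case less
  show ?case
  proof (cases "V = W")
    case True
    moreover have "isometry (\<lambda>x. x)" by (simp add: isometry_def)
    ultimately show ?thesis by (intro exI[of _ "\<lambda>x. x"]) simp
  next
    case False
    then obtain r where r: "F r \<noteq> 0" "vec.dim (reflect r ` V \<inter> W) = vec.dim (V \<inter> W) + 1"
      using gen_step less by blast
    have V': "gen (reflect r ` V)" using r less isometry_gen reflect_isometry by blast
    have "vec.dim (reflect r ` V \<inter> W) \<le> N"
      using vec.dim_subset[of "reflect r ` V \<inter> W" W] gen_dim[OF less.prems(2)] by simp
    then have "N - vec.dim (reflect r ` V \<inter> W) < N - vec.dim (V \<inter> W)" using r by simp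
    from less.hyps[OF this V' less.prems(2)]
    obtain g where "isometry g" "g ` reflect r ` V = W" by blast
    then show ?thesis
      using r reflect_isometry isometry_comp by (intro exI[of _ "g \<circ> reflect r"]) (auto simp: image_comp)
  qed
qed

lemma ex_nonsingular_B:
  assumes "x \<noteq> 0" "F x = 0"
  shows "\<exists>r. F r \<noteq> 0 \<and> B x r \<noteq> 0"
proof -
  obtain y where y: "B x y \<noteq> 0" using B_nondegenerate assms by blast
  show ?thesis
  proof (cases "F y = 0")
    case True
    then have "F (x + y) \<noteq> 0" "B x (x + y) \<noteq> 0"
      using y assms by (simp_all add: F_add B_linear B_self)
    then show ?thesis by blast
  qed (use y in blast)
qed

text \<open>Take \<open>W\<close> with smallest intersection. If it shared a nonzero
  \<open>x\<close> with \<open>U\<close>, reflecting \<open>W\<close> along a nonsingular vector not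
  orthogonal to \<open>x\<close> would remove \<open>x\<close> and make the intersection
  smaller.\<close>

lemma ex_disjoint_gen:
  assumes U: "gen U"
  shows "\<exists>W. gen W \<and> U \<inter> W = {0}"
proof -
  obtain W where W: "gen W" and min: "\<And>W'. gen W' \<Longrightarrow> vec.dim (U \<inter> W) \<le> vec.dim (U \<inter> W')"
    using U exists_least_iff[of "\<lambda>k. \<exists>W. gen W \<and> vec.dim (U \<inter> W) = k"] by (metis not_less)
  have "x = 0" if x: "x \<in> U \<inter> W" for x
  proof (rule ccontr)
    assume "x \<noteq> 0"
    then obtain r where r: "F r \<noteq> 0" "B x r \<noteq> 0"
      using ex_nonsingular_B gen_singular[OF U] x by auto
    have "x \<notin> reflect r ` W" using gen_Int_reflect[OF r(1) W] x r by (auto simp: perp_def)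
    then have "\<not> (U \<inter> W \<subseteq> U \<inter> reflect r ` W)" using x by auto
    then have "vec.dim (U \<inter> W) = vec.dim (U \<inter> reflect r ` W) + 1"
      using gen_Int_reflect_cases[OF r(1) W U] by auto
    then show False using min[of "reflect r ` W"] isometry_gen[OF reflect_isometry W] r by simp
  qed
  then have "U \<inter> W = {0}"
    using vec_subspace_nonzero[of "U \<inter> W"] U W by (simp add: gen_subspace vec.subspace_inter)
  then show ?thesis using W by blast
qed

subsection \<open>Disjoint generators\<close>

text \<open>The neighbourhood of \<open>U\<close> in the disjointness graph.\<close>

definition opp :: "('a ^ 'd) set \<Rightarrow> ('a ^ 'd) set set" where
  "opp U = {W. gen W \<and> U \<inter> W = {0}}"

text \<open>Parities of vector dimensions are opposite to projective ones. For odd \<open>N\<close>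
  the class of \<open>U\<close> is \<open>same U\<close>, and \<open>other U\<close> is the second
  class.\<close>

definition other :: "('a ^ 'd) set \<Rightarrow> ('a ^ 'd) set set" where
  "other U = {W. gen W \<and> even (vec.dim (U \<inter> W))}"

definition same :: "('a ^ 'd) set \<Rightarrow> ('a ^ 'd) set set" where
  "same U = {W. gen W \<and> odd (vec.dim (U \<inter> W))}"

lemma opp_subset_other: "opp U \<subseteq> other U"
  by (auto simp: opp_def other_def)

lemma isometry_image_zero: "isometry g \<Longrightarrow> g ` {0} = {0}"
  using isometry_B[of g 0] by (metis image_empty image_insert isometry_def vec.scale_zero_left)

lemma inj_image_isometry: "isometry g \<Longrightarrow> inj_on ((`) g) A"
  using isometry_inj inj_image_eq_iff by (metis inj_onI)

lemma isometry_image_Int: "isometry g \<Longrightarrow> g ` U \<inter> g ` W = g ` (U \<inter> W)"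
  using isometry_inj image_Int by metis

text \<open>Regularity of the disjointness graph: an isometry from \<open>U\<close> to
  \<open>V\<close> maps neighbours to neighbours injectively, and the roles can be
  exchanged.\<close>

lemma card_opp_eq:
  assumes "gen U" "gen V"
  shows "card (opp U) = card (opp V)"
proof -
  have "card (opp U) \<le> card (opp V)" if UV: "gen U" "gen V" for U V
  proof -
    obtain g where g: "isometry g" "g ` U = V" using gen_transitive UV by blast
    have "((`) g) ` opp U \<subseteq> opp V"
    proof clarify
      fix W assume "W \<in> opp U"
      then have "gen (g ` W)" "g ` U \<inter> g ` W = {0}"
        using isometry_gen[OF g(1)] isometry_image_Int[OF g(1), of U W] isometry_image_zero[OF g(1)]
        by (simp_all add: opp_def)
      then show "g ` W \<in> opp V" using g(2) by (simp add: opp_def)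
    qed
    then show ?thesis by (intro card_inj_on_le[OF inj_image_isometry[OF g(1)]]) auto
  qed
  then show ?thesis using assms by (simp add: antisym)
qed

lemma card_other_eq:
  assumes "gen U" "gen V"
  shows "card (other U) = card (other V)"
proof -
  have "card (other U) \<le> card (other V)" if UV: "gen U" "gen V" for U V
  proof -
    obtain g where g: "isometry g" "g ` U = V" using gen_transitive UV by blast
    have "((`) g) ` other U \<subseteq> other V"
      using g isometry_gen isometry_dim_Int UV by (auto simp: other_def)
    then show ?thesis by (intro card_inj_on_le[OF inj_image_isometry[OF g(1)]]) auto
  qed
  then show ?thesis using assms by (simp add: antisym)
qed

text \<open>The Siegel (or Eichler) transformation of \<open>a\<close> and \<open>b\<close> when
  these lie in one generator; its usual quadratic term vanishes because
  \<open>F b = 0\<close>.\<close>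

definition siegel :: "'a ^ 'd \<Rightarrow> 'a ^ 'd \<Rightarrow> 'a ^ 'd \<Rightarrow> 'a ^ 'd" where
  "siegel a b x = x + B x a *s b - B x b *s a"

lemma
  assumes U: "gen U" and a: "a \<in> U" and b: "b \<in> U"
  shows siegel_isometry: "isometry (siegel a b)"
    and siegel_fixed: "x \<in> U \<Longrightarrow> siegel a b x = x"
    and siegel_B: "c \<in> U \<Longrightarrow> B (siegel a b x) c = B x c"
proof -
  have z: "F a = 0" "F b = 0" "B a a = 0" "B b b = 0" "B a b = 0" "B b a = 0"
    using gen_singular[OF U] gen_B[OF U] a b by auto
  show "isometry (siegel a b)"
    unfolding isometry_def
  proof (intro conjI allI)
    fix x y c
    show "siegel a b (x + y) = siegel a b x + siegel a b y"
      by (simp add: siegel_def B_linear vec.scale_left_distrib)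
    show "siegel a b (c *s x) = c *s siegel a b x"
      by (simp add: siegel_def B_linear vec.scale_right_diff_distrib vec.scale_right_distrib)
    show "F (siegel a b x) = F x"
      by (simp add: siegel_def F_diff F_add F_scale B_linear z)
  qed
  show "x \<in> U \<Longrightarrow> siegel a b x = x" using gen_B[OF U] a b by (simp add: siegel_def)
  show "c \<in> U \<Longrightarrow> B (siegel a b x) c = B x c"
    using gen_B[OF U] a b by (simp add: siegel_def B_linear)
qed

text \<open>For fixed \<open>a\<close> the parameters add, because \<open>siegel a b'\<close>
  preserves all values of \<open>B\<close> against \<open>U\<close>. The multiples of one
  \<open>b\<close> thus give a one-parameter group.\<close>

lemma siegel_siegel:
  assumes U: "gen U" and "a \<in> U" "b \<in> U" "b' \<in> U"
  shows "siegel a b (siegel a b' x) = siegel a (b + b') x"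
  using siegel_B[OF U \<open>a \<in> U\<close> \<open>b' \<in> U\<close>] assms
  by (simp add: siegel_def[of a b "siegel a b' x"])
    (simp add: siegel_def B_linear vec.scale_left_distrib vec.scale_right_distrib)

lemma siegel_zero [simp]: "siegel a 0 x = x"
  by (simp add: siegel_def)

lemma siegel_inverse:
  assumes "gen U" "a \<in> U" "b \<in> U"
  shows "siegel a b (siegel a (- b) x) = x" "siegel a (- b) (siegel a b x) = x"
  using siegel_siegel[OF assms(1,2,3), of "- b"] siegel_siegel[OF assms(1,2), of "- b" b]
    vec.subspace_neg[OF gen_subspace] assms by simp_all

lemma siegel_opp:
  assumes U: "gen U" and "a \<in> U" "b \<in> U" and W: "W \<in> opp U"
  shows "siegel a b ` W \<in> opp U"
proof -
  note g = siegel_isometry[OF assms(1-3)]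
  have "siegel a b ` U = U" using siegel_fixed[OF assms(1-3)] by simp
  moreover have "gen (siegel a b ` W)" "siegel a b ` U \<inter> siegel a b ` W = {0}"
    using W isometry_gen[OF g] isometry_image_Int[OF g, of U W] isometry_image_zero[OF g]
    by (simp_all add: opp_def)
  ultimately show ?thesis by (simp add: opp_def)
qed

text \<open>For a generator \<open>W\<close> and a singular \<open>a\<close> outside it, this is the
  generator spanned by \<open>a\<close> and the hyperplane \<open>W \<inter> perp {a}\<close> of
  \<open>W\<close>.\<close>

definition project :: "'a ^ 'd \<Rightarrow> ('a ^ 'd) set \<Rightarrow> ('a ^ 'd) set" where
  "project a W = {y + c *s a | y c. y \<in> W \<and> B y a = 0}"

text \<open>With \<open>x\<close> in \<open>W\<close> not orthogonal to \<open>a\<close>, the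
  reflection along \<open>x - a\<close> sends \<open>x\<close> to \<open>a\<close> and fixes the
  vectors of \<open>W\<close> orthogonal to \<open>a\<close>.\<close>

lemma project_reflect:
  assumes W: "gen W" and a: "F a = 0" "a \<notin> W"
  shows "\<exists>r. F r \<noteq> 0 \<and> project a W = reflect r ` W"
proof -
  obtain x where x: "x \<in> W" "B x a \<noteq> 0" using notin_gen[OF W a(2)] B_sym by metis
  have Fx: "F x = 0" using gen_singular[OF W] x by simp
  let ?r = "x - a"
  note r = reflect_to[OF Fx a(1) x(2)]
  have G: "gen (reflect ?r ` W)" using isometry_gen reflect_isometry r W by blast
  have sub: "project a W \<subseteq> reflect ?r ` W"
  proof
    fix z assume "z \<in> project a W"
    then obtain y c where y: "y \<in> W" "B y a = 0" "z = y + c *s a" by (auto simp: project_def)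
    have "B y x = 0" using gen_B[OF W] y x by blast
    then have "reflect ?r y = y" using y by (intro reflect_fixed) (simp add: B_linear)
    then have "y \<in> reflect ?r ` W" using y by (metis imageI)
    moreover have "a \<in> reflect ?r ` W" using r(2) x(1) by (metis imageI)
    ultimately show "z \<in> reflect ?r ` W"
      using y G by (simp add: gen_subspace vec.subspace_add vec.subspace_scale)
  qed
  have "reflect ?r ` W \<subseteq> project a W"
  proof clarify
    fix w assume w: "w \<in> W"
    let ?t = "B w a / B x a"
    have e: "F ?r = - B x a" using Fx a by (simp add: F_diff)
    have Bw: "B w ?r = - B w a" using gen_B[OF W w x(1)] by (simp add: B_linear)
    have "reflect ?r w = (w - ?t *s x) + ?t *s a"
      using x(2) by (simp add: reflect_def e Bw vec.scale_right_diff_distrib)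
    moreover have "w - ?t *s x \<in> W"
      using w x W by (simp add: gen_subspace vec.subspace_diff vec.subspace_scale)
    moreover have "B (w - ?t *s x) a = 0" using x by (simp add: B_linear)
    ultimately show "reflect ?r w \<in> project a W" unfolding project_def by blast
  qed
  with sub r(1) show ?thesis by blast
qed

text \<open>On vectors orthogonal to \<open>a\<close>, \<open>siegel a b\<close> only adds multiples
  of \<open>a\<close>, which the projection absorbs.\<close>

lemma project_siegel_le:
  assumes U: "gen U" and a: "a \<in> U" and b: "b \<in> U"
  shows "project a (siegel a b ` W) \<subseteq> project a W"
proof
  fix z assume "z \<in> project a (siegel a b ` W)"
  then obtain w c where w: "w \<in> W" "B (siegel a b w) a = 0" "z = siegel a b w + c *s a"
    by (auto simp: project_def)
  then have "B w a = 0" using siegel_B[OF U a b a] by simp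
  moreover then have "z = w + (c - B w b) *s a"
    by (simp add: w siegel_def vec.scale_left_diff_distrib)
  ultimately show "z \<in> project a W" using w by (auto simp: project_def)
qed

lemma project_siegel:
  assumes U: "gen U" and a: "a \<in> U" and b: "b \<in> U"
  shows "project a (siegel a b ` W) = project a W"
proof (rule antisym[OF project_siegel_le[OF assms]])
  have "- b \<in> U" using U b by (simp add: gen_subspace vec.subspace_neg)
  from project_siegel_le[OF U a this, of "siegel a b ` W"]
  show "project a W \<subseteq> project a (siegel a b ` W)"
    by (simp add: image_image siegel_inverse[OF assms])
qed

text \<open>Moving \<open>W\<close> along a one-parameter group of Siegel transformations that fix \<open>U\<close> pointwise,
  one reaches a generator meeting \<open>V\<close>; the group depends only on the projection of \<open>W\<close> from a
  point of \<open>U\<close> outside \<open>V\<close>, which it leaves invariant, so that its orbits partition \<open>opp U\<close>.\<close>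

lemma card_opp_le:
  assumes oddN: "odd N" and U: "gen U" and V: "V \<in> same U" and ne: "U \<noteq> V"
  shows "card (opp U) \<le> CARD('a) * card (opp U - opp V)"
proof -
  have gV: "gen V" using V by (simp add: same_def)
  have "\<not> U \<subseteq> V"
    using vec.subspace_dim_equal[of U V] U gV ne by (auto simp: gen_def)
  then obtain a where a: "a \<in> U" "a \<notin> V" by auto
  have Fa: "F a = 0" using gen_singular[OF U] a by simp
  have neg: "- c \<in> U" if "c \<in> U" for c using U that by (simp add: gen_subspace vec.subspace_neg)
  have scl: "t *s c \<in> U" if "c \<in> U" for c t using U that by (simp add: gen_subspace vec.subspace_scale)
  \<comment> \<open>The choices depend on the projection \<open>G\<close> only, so that all
    generators in one orbit use the same \<open>b\<close>.\<close>
  define z where "z G = (SOME z. z \<in> G \<inter> V \<and> z \<noteq> 0)" for G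
  define b where "b G = (SOME b. b \<in> U \<and> B (z G) b \<noteq> 0)" for G
  have main: "b (project a W) \<in> U \<and> (\<exists>t. siegel a (t *s b (project a W)) ` W \<notin> opp V)"
    if W: "W \<in> opp U" for W
  proof -
    let ?G = "project a W"
    have gW: "gen W" and UW: "U \<inter> W = {0}" using W by (auto simp: opp_def)
    have "a \<noteq> 0" using a gV vec.subspace_0 gen_subspace by blast
    then have "a \<notin> W" using a UW by blast
    then obtain r where r: "F r \<noteq> 0" "?G = reflect r ` W"
      using project_reflect[OF gW Fa] by blast
    have gG: "gen ?G" using r isometry_gen reflect_isometry gW by simp
    \<comment> \<open>The projection is a reflected copy of \<open>W\<close>, so it meets
      \<open>V\<close> in odd dimension and hence in a nonzero vector.\<close>
    have "even (vec.dim (V \<inter> W))"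
      using gen_parity[OF U gV gW] V oddN UW by (simp add: same_def)
    then have "odd (vec.dim (V \<inter> ?G))" using even_dim_Int_reflect[OF r(1) gW gV] r(2) by simp
    then have "\<not> ?G \<inter> V \<subseteq> {0}" by (metis Int_commute even_zero vec.dim_eq_0)
    then have "\<exists>z. z \<in> ?G \<inter> V \<and> z \<noteq> 0" by auto
    then have z: "z ?G \<in> ?G \<inter> V \<and> z ?G \<noteq> 0" unfolding z_def by (rule someI_ex)
    obtain y c where y: "y \<in> W" "B y a = 0" "z ?G = y + c *s a"
      using z by (auto simp: project_def)
    have "z ?G \<notin> U"
    proof
      assume "z ?G \<in> U"
      then have "z ?G - c *s a \<in> U" using scl[OF a(1)] U by (simp add: gen_subspace vec.subspace_diff)
      then have "y = 0" using y UW by auto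
      then have "c \<noteq> 0" "c *s a \<in> V" using y z by auto
      then have "inverse c *s (c *s a) \<in> V" using gV gen_subspace vec.subspace_scale by blast
      then show False using a \<open>c \<noteq> 0\<close> by simp
    qed
    then have "\<exists>b. b \<in> U \<and> B (z ?G) b \<noteq> 0" using notin_gen[OF U] by blast
    then have b: "b ?G \<in> U \<and> B (z ?G) (b ?G) \<noteq> 0" unfolding b_def by (rule someI_ex)
    then have Bb: "B y (b ?G) \<noteq> 0" using y gen_B[OF U a(1)] by (auto simp: B_linear)
    \<comment> \<open>As \<open>B y a = 0\<close>, parameter \<open>t\<close> moves \<open>y\<close>
      by \<open>- t * B y (b ?G)\<close> times \<open>a\<close>; this value turns \<open>y\<close>
      into \<open>z ?G\<close>.\<close>
    let ?t = "- c / B y (b ?G)"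
    have "siegel a (?t *s b ?G) y = z ?G"
      using y Bb by (simp add: siegel_def B_linear)
    then have "z ?G \<in> siegel a (?t *s b ?G) ` W" using y(1) by (metis imageI)
    then have "siegel a (?t *s b ?G) ` W \<notin> opp V" using z by (auto simp: opp_def)
    then show ?thesis using b by blast
  qed
  have "opp U \<subseteq> (\<Union>W\<in>opp U - opp V. range (\<lambda>t. siegel a (t *s b (project a W)) ` W))"
  proof
    fix W assume W: "W \<in> opp U"
    let ?b = "b (project a W)"
    obtain t where b: "?b \<in> U" and t: "siegel a (t *s ?b) ` W \<notin> opp V" using main[OF W] by blast
    let ?W = "siegel a (t *s ?b) ` W"
    have tb: "t *s ?b \<in> U" using scl[OF b] .
    have "project a ?W = project a W" by (rule project_siegel[OF U a(1) tb])
    \<comment> \<open>\<open>W\<close> is recovered from \<open>?W\<close> and one scalar, so each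
      element of \<open>opp U - opp V\<close> accounts for at most \<open>CARD('a)\<close> elements
      of \<open>opp U\<close>.\<close>
    then have "siegel a (- t *s b (project a ?W)) ` ?W = W"
      using siegel_inverse(2)[OF U a(1) tb] by (simp add: image_image)
    moreover have "?W \<in> opp U - opp V" using siegel_opp[OF U a(1) tb W] t by simp
    ultimately show "W \<in> (\<Union>W\<in>opp U - opp V. range (\<lambda>t. siegel a (t *s b (project a W)) ` W))"
      by (metis (no_types, lifting) UN_I rangeI)
  qed
  then have "card (opp U) \<le> card (\<Union>W\<in>opp U - opp V. range (\<lambda>t. siegel a (t *s b (project a W)) ` W))"
    by (intro card_mono) auto
  also have "\<dots> \<le> (\<Sum>W\<in>opp U - opp V. card (range (\<lambda>t. siegel a (t *s b (project a W)) ` W)))"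
    by (intro card_UN_le) auto
  also have "\<dots> \<le> (\<Sum>W\<in>opp U - opp V. CARD('a))" by (intro sum_mono card_image_le) auto
  finally show ?thesis by (simp add: mult.commute)
qed

subsection \<open>Generators through a point\<close>

text \<open>A generator \<open>W\<close> disjoint from some \<open>U\<close> through
  \<open>x\<close> avoids \<open>x\<close>. If it contains \<open>y\<close>, a Siegel transformation
  with \<open>a\<close> not orthogonal to \<open>y\<close> and \<open>b\<close> independent of
  \<open>a\<close> moves it off \<open>y\<close>; such a \<open>b\<close> exists because
  \<open>N \<ge> 2\<close>.\<close>

lemma ex_gen_avoiding:
  assumes x: "F x = 0" "x \<noteq> 0" and y: "F y = 0" "y \<noteq> 0" and N: "N \<ge> 2"
  shows "\<exists>W. gen W \<and> x \<notin> W \<and> y \<notin> W"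
proof -
  have "\<forall>z\<in>vec.span {x}. F z = 0" using x by (auto simp: vec.span_singleton F_scale)
  then obtain U where U: "gen U" "vec.span {x} \<subseteq> U"
    using ex_gen_superset[of "vec.span {x}"] by auto
  then have xU: "x \<in> U" using vec.span_base by blast
  obtain W where W: "W \<in> opp U" using ex_disjoint_gen[OF U(1)] by (auto simp: opp_def)
  then have UW: "U \<inter> W = {0}" by (simp add: opp_def)
  show ?thesis
  proof (cases "y \<in> W")
    case False
    then show ?thesis using W x xU by (auto simp: opp_def)
  next
    case True
    then have "y \<notin> U" using UW y by blast
    then obtain a where a: "a \<in> U" "B y a \<noteq> 0" using notin_gen[OF U(1)] by blast
    have "\<not> U \<subseteq> vec.span {a}"
    proof
      assume "U \<subseteq> vec.span {a}"
      then have "vec.dim U \<le> vec.dim {a}" by (rule vec.dim_mono)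
      also have "\<dots> \<le> 1" by simp
      finally show False using N gen_dim[OF U(1)] by simp
    qed
    then obtain b where b: "b \<in> U" "b \<notin> vec.span {a}" by blast
    let ?W = "siegel a b ` W"
    have V: "?W \<in> opp U" by (rule siegel_opp[OF U(1) a(1) b(1) W])
    have "y \<notin> ?W"
    proof
      assume "y \<in> ?W"
      then obtain w where w: "w \<in> W" "y = siegel a b w" by blast
      then have "y - w = B w a *s b - B w b *s a" by (simp add: siegel_def)
      moreover have "B w a = B y a" using w siegel_B[OF U(1) a(1) b(1) a(1)] by simp
      moreover have "B w a *s b - B w b *s a \<in> U"
        using a(1) b(1) gen_subspace[OF U(1)] vec.subspace_diff vec.subspace_scale by metis
      moreover have "y - w \<in> W" using w True W by (simp add: opp_def gen_subspace vec.subspace_diff)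
      ultimately have e: "B y a *s b = B w b *s a" using UW by (metis IntI eq_iff_diff_eq_0 singletonD)
      have "b = inverse (B y a) *s (B y a *s b)" using a by simp
      also have "\<dots> = (inverse (B y a) * B w b) *s a" by (simp add: e)
      finally show False using b(2) by (simp add: vec.span_singleton)
    qed
    moreover have "x \<notin> ?W" using V xU x by (auto simp: opp_def)
    ultimately show ?thesis using V by (auto simp: opp_def)
  qed
qed

text \<open>On a generator avoiding \<open>x\<close> and \<open>y\<close>, both define nonzero
  functionals; one of \<open>u\<close>, \<open>v\<close>, \<open>u + v\<close> lies in neither
  kernel.\<close>

lemma ex_common_nonorthogonal:
  assumes x: "F x = 0" "x \<noteq> 0" and y: "F y = 0" "y \<noteq> 0" and N: "N \<ge> 2"
  shows "\<exists>z. F z = 0 \<and> B x z \<noteq> 0 \<and> B y z \<noteq> 0"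
proof -
  obtain W where W: "gen W" "x \<notin> W" "y \<notin> W" using ex_gen_avoiding[OF assms] by blast
  obtain u where u: "u \<in> W" "B x u \<noteq> 0" using notin_gen W by blast
  obtain v where v: "v \<in> W" "B y v \<noteq> 0" using notin_gen W by blast
  have uv: "u + v \<in> W" using u v W by (simp add: gen_subspace vec.subspace_add)
  show ?thesis
  proof (cases "B y u = 0 \<and> B x v = 0")
    case True
    then have "B x (u + v) \<noteq> 0" "B y (u + v) \<noteq> 0" using u v by (simp_all add: B_linear)
    then show ?thesis using uv W gen_singular by blast
  qed (use u v W gen_singular in blast)
qed

text \<open>The reflection taking \<open>x\<close> to \<open>z\<close> exchanges the two
  classes.\<close>

lemma card_through_le_swap:
  assumes U: "gen U" and xz: "F x = 0" "F z = 0" "B x z \<noteq> 0"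
  shows "card {W \<in> other U. x \<in> W} \<le> card {W \<in> same U. z \<in> W}"
    and "card {W \<in> same U. x \<in> W} \<le> card {W \<in> other U. z \<in> W}"
proof -
  note r = reflect_to[OF xz]
  note g = reflect_isometry[OF r(1)]
  have z: "z \<in> reflect (x - z) ` W" if "x \<in> W" for W using r(2) that by (metis imageI)
  have "((`) (reflect (x - z))) ` {W \<in> other U. x \<in> W} \<subseteq> {W \<in> same U. z \<in> W}"
    using z isometry_gen[OF g] even_dim_Int_reflect[OF r(1) _ U] by (auto simp: other_def same_def)
  then show "card {W \<in> other U. x \<in> W} \<le> card {W \<in> same U. z \<in> W}"
    by (intro card_inj_on_le[OF inj_image_isometry[OF g]]) auto
  have "((`) (reflect (x - z))) ` {W \<in> same U. x \<in> W} \<subseteq> {W \<in> other U. z \<in> W}"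
    using z isometry_gen[OF g] even_dim_Int_reflect[OF r(1) _ U] by (auto simp: other_def same_def)
  then show "card {W \<in> same U. x \<in> W} \<le> card {W \<in> other U. z \<in> W}"
    by (intro card_inj_on_le[OF inj_image_isometry[OF g]]) auto
qed

text \<open>Passing from \<open>x\<close> to \<open>y\<close> through \<open>z\<close> uses two
  reflections, which restores the class.\<close>

lemma card_other_through:
  assumes U: "gen U" and x: "F x = 0" "x \<noteq> 0" and y: "F y = 0" "y \<noteq> 0" and N: "N \<ge> 2"
  shows "card {W \<in> other U. x \<in> W} = card {W \<in> other U. y \<in> W}"
proof -
  obtain z where z: "F z = 0" "B x z \<noteq> 0" "B y z \<noteq> 0"
    using ex_common_nonorthogonal[OF x y N] by blast
  have z': "B z x \<noteq> 0" "B z y \<noteq> 0" using z B_sym by metis+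
  note le = card_through_le_swap[OF U]
  show ?thesis
    using le(1)[OF x(1) z(1,2)] le(2)[OF z(1) y(1) z'(2)]
      le(1)[OF y(1) z(1) z(3)] le(2)[OF z(1) x(1) z'(1)] by linarith
qed

lemma card_gen: "gen U \<Longrightarrow> card U = CARD('a) ^ N"
  using card_vec_subspace by (auto simp: gen_def)

lemma card_gen_nonzero: "gen U \<Longrightarrow> card (U - {0}) = CARD('a) ^ N - 1"
  using card_gen vec.subspace_0[OF gen_subspace] by simp

text \<open>For disjoint generators \<open>U\<close> and \<open>W\<close>, every sum of a nonzero
  \<open>z\<close> in \<open>W\<close> and a vector of \<open>U\<close> orthogonal to
  \<open>z\<close> is singular and nonzero, and distinct pairs give distinct sums.\<close>

lemma card_singular_ge:
  assumes N: "N \<ge> 1"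
  shows "(CARD('a) ^ N - 1) * CARD('a) ^ (N - 1) \<le> card {x. F x = 0 \<and> x \<noteq> 0}"
proof -
  obtain U where U: "gen U" using ex_singular_subspace by (auto simp: gen_def)
  obtain W where W: "gen W" "U \<inter> W = {0}" using ex_disjoint_gen[OF U] by blast
  let ?T = "SIGMA z:W - {0}. U \<inter> {y. B y z = 0}"
  let ?f = "\<lambda>(z, y). z + y"
  have "CARD('a) ^ (N - 1) \<le> card (U \<inter> {y. B y z = 0})" for z
  proof -
    have "vec.dim U \<le> vec.dim (U \<inter> {y. B y z = 0}) + 1"
      by (rule vec_dim_le_dim_kernel) (simp_all add: U gen_subspace B_linear)
    moreover have "vec.subspace (U \<inter> perp {z})" using U by (simp add: gen_subspace subspace_perp vec.subspace_inter)
    ultimately show ?thesis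
      using card_vec_subspace[of "U \<inter> perp {z}"] gen_dim[OF U]
      by (simp add: perp_def power_increasing Suc_le_eq)
  qed
  then have "(\<Sum>z\<in>W - {0}. CARD('a) ^ (N - 1)) \<le> (\<Sum>z\<in>W - {0}. card (U \<inter> {y. B y z = 0}))"
    by (intro sum_mono) auto
  then have T: "(CARD('a) ^ N - 1) * CARD('a) ^ (N - 1) \<le> card ?T"
    by (simp add: card_gen_nonzero W)
  have "inj_on ?f ?T"
  proof (rule inj_onI)
    fix s s' assume s: "s \<in> ?T" "s' \<in> ?T" "?f s = ?f s'"
    obtain z y z' y' where p: "s = (z, y)" "s' = (z', y')" by fastforce
    then have a: "z \<in> W" "z' \<in> W" "y \<in> U" "y' \<in> U" and e: "z + y = z' + y'"
      using s by auto
    have d: "z - z' = y' - y" using e by (simp add: algebra_simps)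
    have "z - z' \<in> W" "y' - y \<in> U" using a U W by (simp_all add: gen_subspace vec.subspace_diff)
    then have "z - z' = 0" using W(2) d by (metis IntI singletonD)
    then show "s = s'" using e p by simp
  qed
  then have "card (?f ` ?T) = card ?T" by (simp add: card_image)
  then have "(CARD('a) ^ N - 1) * CARD('a) ^ (N - 1) \<le> card (?f ` ?T)" using T by simp
  also have "\<dots> \<le> card {x. F x = 0 \<and> x \<noteq> 0}"
  proof (intro card_mono subsetI)
    fix x assume "x \<in> ?f ` ?T"
    then obtain z y where zy: "z \<in> W" "z \<noteq> 0" "y \<in> U" "B y z = 0" "x = z + y" by auto
    have "x \<noteq> 0"
    proof
      assume "x = 0"
      then have "z = - y" using zy by (simp add: eq_neg_iff_add_eq_0)
      then have "z \<in> U" using zy U by (simp add: gen_subspace vec.subspace_neg)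
      then show False using zy W by blast
    qed
    then show "x \<in> {x. F x = 0 \<and> x \<noteq> 0}"
      using zy gen_singular[OF U] gen_singular[OF W(1)] B_sym[of y z] by (simp add: F_add)
  qed simp
  finally show ?thesis .
qed

lemma sum_card_through:
  fixes A :: "('a ^ 'd) set"
  shows "(\<Sum>x\<in>A. card {W \<in> S. x \<in> W}) = (\<Sum>W\<in>S. card (A \<inter> W))"
proof -
  have "(\<Sum>x\<in>A. \<Sum>W\<in>{W \<in> S. x \<in> W}. 1) = (\<Sum>W\<in>S. \<Sum>x\<in>{x \<in> A. x \<in> W}. 1::nat)"
    by (rule sum.swap_restrict) auto
  then show ?thesis by (simp add: Int_def)
qed

text \<open>A singular vector lies in about \<open>q ^ (1 - N)\<close> of the generators of a class, and a generator
  of the class not containing \<open>U\<close> that meets \<open>U\<close> has at least \<open>q\<^sup>2 - 1\<close> nonzero vectors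
  in common with it.\<close>

lemma card_other_meeting_le:
  assumes U: "gen U" and N: "N \<ge> 2"
  shows "(CARD('a)\<^sup>2 - 1) * card (other U - opp U) \<le> CARD('a) * card (other U)"
proof -
  let ?q = "CARD('a)"
  let ?S = "{x. F x = 0 \<and> x \<noteq> 0}"
  have q: "?q \<ge> 1" by (simp add: Suc_le_eq)
  have "U \<noteq> {0}" using gen_dim[OF U] N by auto
  then obtain a where a: "a \<in> U" "a \<noteq> 0" using vec_subspace_nonzero gen_subspace U by metis
  define c where "c = card {W \<in> other U. a \<in> W}"
  have c: "card {W \<in> other U. x \<in> W} = c" if "F x = 0" "x \<noteq> 0" for x
    unfolding c_def using card_other_through[OF U that _ a(2) N] gen_singular[OF U a(1)] by simp
  have "card ?S * c = (\<Sum>x\<in>?S. card {W \<in> other U. x \<in> W})" using c by simp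
  also have "\<dots> = (\<Sum>W\<in>other U. card (?S \<inter> W))" by (rule sum_card_through)
  also have "\<dots> = (\<Sum>W\<in>other U. ?q ^ N - 1)"
  proof (rule sum.cong[OF refl])
    fix W assume "W \<in> other U"
    then have W: "gen W" by (simp add: other_def)
    then have "?S \<inter> W = W - {0}" using gen_singular by auto
    then show "card (?S \<inter> W) = ?q ^ N - 1" using card_gen_nonzero W by simp
  qed
  finally have Sc: "card ?S * c = (?q ^ N - 1) * card (other U)" by (simp add: mult.commute)
  have "(?q ^ N - 1) * ?q ^ (N - 1) * c \<le> card ?S * c"
    by (rule mult_right_mono[OF card_singular_ge]) (use N in simp_all)
  then have "(?q ^ N - 1) * (?q ^ (N - 1) * c) \<le> (?q ^ N - 1) * card (other U)"
    unfolding Sc mult.assoc .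
  moreover have "?q ^ N - 1 > 0"
  proof -
    have "card (U - {0}) > 0" using a by (auto simp: card_gt_0_iff)
    then show ?thesis using card_gen_nonzero U by simp
  qed
  ultimately have cK: "?q ^ (N - 1) * c \<le> card (other U)" by (simp only: mult_le_cancel1)
  have "(?q\<^sup>2 - 1) * card (other U - opp U) = (\<Sum>W\<in>other U - opp U. ?q\<^sup>2 - 1)" by simp
  also have "\<dots> \<le> (\<Sum>W\<in>other U - opp U. card ((U - {0}) \<inter> W))"
  proof (rule sum_mono)
    fix W assume "W \<in> other U - opp U"
    then have W: "gen W" "even (vec.dim (U \<inter> W))" "U \<inter> W \<noteq> {0}" by (auto simp: other_def opp_def)
    have sub: "vec.subspace (U \<inter> W)" using U W by (simp add: gen_subspace vec.subspace_inter)
    have "vec.dim (U \<inter> W) \<noteq> 0" using W(3) vec.subspace_0[OF sub] by auto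
    then have "vec.dim (U \<inter> W) \<ge> 2" using dvd_imp_le[OF W(2)] by (simp del: vec.dim_eq_0)
    then have "?q\<^sup>2 \<le> card (U \<inter> W)" using card_vec_subspace[OF sub] q by (simp add: power_increasing)
    moreover have "(U - {0}) \<inter> W = (U \<inter> W) - {0}" by blast
    ultimately show "?q\<^sup>2 - 1 \<le> card ((U - {0}) \<inter> W)" using vec.subspace_0[OF sub] by simp
  qed
  also have "\<dots> \<le> (\<Sum>W\<in>other U. card ((U - {0}) \<inter> W))" by (rule sum_mono2) auto
  also have "\<dots> = (\<Sum>x\<in>U - {0}. card {W \<in> other U. x \<in> W})" by (rule sum_card_through[symmetric])
  also have "\<dots> = (?q ^ N - 1) * c" using c gen_singular[OF U] card_gen_nonzero[OF U] by simp
  also have "\<dots> \<le> ?q * (?q ^ (N - 1) * c)" using N by (cases N) auto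
  also have "\<dots> \<le> ?q * card (other U)" using cK by simp
  finally show ?thesis .
qed

lemma card_other_le:
  assumes U: "gen U" and N: "N \<ge> 2" and q: "CARD('a) \<ge> 3"
  shows "CARD('a) * card (other U) \<le> (CARD('a) + 2) * card (opp U)"
proof -
  define q K D where "q = real CARD('a)" and "K = real (card (other U))" and "D = real (card (opp U))"
  have q3: "q \<ge> 3" using q by (simp add: q_def)
  have fin: "finite (opp U)" by simp
  have "card (opp U) \<le> card (other U)" using opp_subset_other by (intro card_mono) auto
  then have dK: "real (card (other U - opp U)) = K - D"
    using card_Diff_subset[OF fin opp_subset_other] by (simp add: K_def D_def)
  have "real ((CARD('a)\<^sup>2 - 1) * card (other U - opp U)) \<le> real (CARD('a) * card (other U))"
    using card_other_meeting_le[OF U N] by (simp only: of_nat_le_iff)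
  then have m: "(q\<^sup>2 - 1) * (K - D) \<le> q * K"
    using q by (simp add: dK q_def K_def of_nat_diff flip: of_nat_power)
  define P where "P = q\<^sup>2 - q - 1"
  have qq: "3 * q \<le> q * q" using q3 by (simp add: mult_right_mono)
  \<comment> \<open>The condition \<open>q \<ge> 3\<close> enters here: the right-hand side is
    positive for such \<open>q\<close>, but negative for \<open>q = 2\<close>.\<close>
  have "(q + 2) * P - q * (q\<^sup>2 - 1) = q * q - 2 * q - 2"
    by (simp add: P_def power2_eq_square algebra_simps)
  then have P: "P > 0" "q * (q\<^sup>2 - 1) \<le> (q + 2) * P"
    using q3 qq unfolding P_def power2_eq_square by linarith+
  have "P * K \<le> (q\<^sup>2 - 1) * D" using m by (simp add: P_def algebra_simps)
  then have "q * (P * K) \<le> q * ((q\<^sup>2 - 1) * D)" using q3 by (intro mult_left_mono) auto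
  also have "\<dots> \<le> (q + 2) * P * D"
    using mult_right_mono[OF P(2), of D] by (simp add: D_def mult.assoc)
  finally have "P * (q * K) \<le> P * ((q + 2) * D)" by (simp add: algebra_simps)
  then have "q * K \<le> (q + 2) * D" using P(1) by simp
  then have "real (CARD('a) * card (other U)) \<le> real ((CARD('a) + 2) * card (opp U))"
    by (simp add: q_def K_def D_def algebra_simps)
  then show ?thesis by (simp only: of_nat_le_iff)
qed

subsection \<open>Erdos-Ko-Rado sets\<close>

lemma same_refl: "odd N \<Longrightarrow> gen U \<Longrightarrow> U \<in> same U"
  by (simp add: same_def gen_def)

lemma same_eq:
  assumes "odd N" "gen U" "V \<in> same U"
  shows "same V = same U" "other V = other U"
  using assms gen_parity[OF assms(2)] by (auto simp: same_def other_def)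

lemma same_other:
  assumes "odd N" "gen U" "V \<in> other U"
  shows "same V = other U" "other V = same U"
  using assms gen_parity[OF assms(2)] by (auto simp: same_def other_def)

lemma ex_nonsingular_reflect:
  assumes U: "gen U" and N: "N \<ge> 1"
  shows "\<exists>r. F r \<noteq> 0"
proof -
  have "U \<noteq> {0}" using gen_dim[OF U] N by auto
  then obtain a where "a \<in> U" "a \<noteq> 0" using vec_subspace_nonzero gen_subspace U by metis
  then show ?thesis using ex_nonsingular_B gen_singular[OF U] by blast
qed

text \<open>A reflection interchanges the classes, so \<open>same U\<close> is \<open>other\<close>
  of the reflected generator.\<close>

lemma card_same:
  assumes U: "gen U" and N: "N \<ge> 1"
  shows "card (same U) = card (other U)"
proof -
  obtain r where r: "F r \<noteq> 0" using ex_nonsingular_reflect assms by blast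
  have "gen (reflect r ` U)" using isometry_gen reflect_isometry r U by blast
  moreover have "other (reflect r ` U) = same U"
    using even_dim_Int_reflect[OF r U] by (auto simp: other_def same_def Int_commute)
  ultimately show ?thesis using card_other_eq U by metis
qed

lemma opp_not_subset:
  assumes "odd N" and U: "gen U" and V: "V \<in> same U" "U \<noteq> V"
  shows "\<not> opp U \<subseteq> opp V"
proof -
  have "opp U \<noteq> {}" using ex_disjoint_gen[OF U] by (auto simp: opp_def)
  then have "card (opp U) > 0" by (simp add: card_gt_0_iff)
  then have "card (opp U - opp V) > 0" using card_opp_le[OF assms] by (metis gr0I le_zero_eq mult_0_right)
  then show ?thesis by (metis Diff_eq_empty_iff card.empty less_irrefl)
qed

text \<open>The sets \<open>opp V\<close>, \<open>opp U - opp V\<close> and \<open>T\<close> are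
  disjoint subsets of one class, and \<open>card_opp_le\<close> bounds the second from
  below.\<close>

lemma card_missed_by_two:
  assumes "odd N" and U: "gen U" and V: "V \<in> same U" "U \<noteq> V"
    and T: "T \<subseteq> other U" "T \<inter> opp U = {}" "T \<inter> opp V = {}"
  shows "(CARD('a) + 1) * card (opp U) + CARD('a) * card T \<le> CARD('a) * card (other U)"
proof -
  have gV: "gen V" using V by (simp add: same_def)
  have "card (opp V \<union> (opp U - opp V)) = card (opp V) + card (opp U - opp V)"
    by (rule card_Un_disjoint) auto
  moreover have "card (opp V \<union> (opp U - opp V) \<union> T) = card (opp V \<union> (opp U - opp V)) + card T"
    by (rule card_Un_disjoint) (use T in auto)
  ultimately have "card (opp V) + card (opp U - opp V) + card T = card (opp V \<union> (opp U - opp V) \<union> T)"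
    by simp
  also have "\<dots> \<le> card (other U)"
    using T(1) opp_subset_other[of U] opp_subset_other[of V] same_eq(2)[OF assms(1) U V(1)]
    by (intro card_mono) auto
  finally have "CARD('a) * (card (opp U) + card (opp U - opp V) + card T) \<le> CARD('a) * card (other U)"
    using card_opp_eq[OF U gV] by simp
  then show ?thesis using card_opp_le[OF assms(1-4)] by (simp add: algebra_simps)
qed

definition ekr :: "('a ^ 'd) set set \<Rightarrow> bool" where
  "ekr S \<longleftrightarrow> (\<forall>U\<in>S. gen U) \<and> (\<forall>U\<in>S. \<forall>W\<in>S. U \<inter> W \<noteq> {0})"

definition type_B :: "('a ^ 'd) set \<Rightarrow> ('a ^ 'd) set set" where
  "type_B U = insert U (other U - opp U)"

lemma same_meets:
  assumes "W \<in> same U"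
  shows "U \<inter> W \<noteq> {0}"
proof
  assume "U \<inter> W = {0}"
  then have "vec.dim (U \<inter> W) = 0" by simp
  then show False using assms unfolding same_def by (metis (mono_tags) even_zero mem_Collect_eq)
qed

lemma other_iff_not_same: "gen W \<Longrightarrow> W \<in> other U \<longleftrightarrow> W \<notin> same U"
  by (simp add: same_def other_def)

lemma ekr_same:
  assumes "odd N" "gen U"
  shows "ekr (same U)"
  unfolding ekr_def
proof (intro conjI ballI)
  show "V \<inter> W \<noteq> {0}" if "V \<in> same U" "W \<in> same U" for V W
    using same_meets[of W V] same_eq(1)[OF assms that(1)] that by simp
qed (simp add: same_def)

lemma ekr_type_B:
  assumes "odd N" "gen U"
  shows "ekr (type_B U)"
  unfolding ekr_def
proof (intro conjI ballI)
  fix V W assume V: "V \<in> type_B U" and W: "W \<in> type_B U"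
  have *: "U \<inter> W' \<noteq> {0}" if "W' \<in> type_B U" for W'
    using that same_meets[OF same_refl[OF assms]] by (auto simp: type_B_def opp_def other_def)
  show "V \<inter> W \<noteq> {0}"
  proof (cases "V = U \<or> W = U")
    case True
    then show ?thesis using *[OF V] *[OF W] by (metis Int_commute)
  next
    case False
    then have "V \<in> other U" "W \<in> other U" using V W by (auto simp: type_B_def)
    then show ?thesis using same_meets[of W V] same_other(1)[OF assms] by simp
  qed
qed (use assms in \<open>auto simp: type_B_def other_def\<close>)

text \<open>A further generator would lie in the second class and be disjoint from some element of
  \<open>same U\<close>.\<close>

lemma same_maximal:
  assumes "odd N" "gen U" and T: "ekr T" "same U \<subseteq> T"
  shows "T = same U"
proof (rule ccontr)
  assume "T \<noteq> same U"
  then obtain W where W: "W \<in> T" "W \<notin> same U" using T by blast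
  then have gW: "gen W" "W \<in> other U" using T other_iff_not_same by (auto simp: ekr_def)
  obtain V where V: "V \<in> opp W" using ex_disjoint_gen[OF gW(1)] by (auto simp: opp_def)
  then have "V \<in> T" using opp_subset_other same_other(2)[OF assms(1,2) gW(2)] T by blast
  then show False using V W T by (auto simp: ekr_def opp_def)
qed

text \<open>A further \<open>V\<close> cannot be disjoint from \<open>U\<close>, so it lies in the
  class of \<open>U\<close>. By \<open>opp_not_subset\<close> some \<open>W\<close> is disjoint from
  \<open>V\<close> but not from \<open>U\<close>, and this \<open>W\<close> belongs to
  \<open>type_B U\<close>.\<close>

lemma type_B_maximal:
  assumes "odd N" "gen U" and T: "ekr T" "type_B U \<subseteq> T"
  shows "T = type_B U"
proof (rule ccontr)
  assume "T \<noteq> type_B U"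
  then obtain V where V: "V \<in> T" "V \<notin> type_B U" using T by blast
  have gV: "gen V" using V T by (auto simp: ekr_def)
  have "U \<in> T" using T by (auto simp: type_B_def)
  then have "V \<notin> opp U" using V T by (auto simp: ekr_def opp_def)
  then have sV: "V \<in> same U" "V \<noteq> U" using V gV other_iff_not_same by (auto simp: type_B_def)
  have eq: "same V = same U" "other V = other U" using same_eq[OF assms(1,2) sV(1)] by auto
  have "U \<in> same V" using same_refl assms(1,2) eq by simp
  then obtain W where W: "W \<in> opp V" "W \<notin> opp U"
    using opp_not_subset[OF assms(1) gV] sV(2) by blast
  then have "W \<in> T" using opp_subset_other[of V] eq T by (auto simp: type_B_def)
  then show False using W V T by (auto simp: ekr_def opp_def)
qed

lemma card_type_B:
  assumes "odd N" "gen U"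
  shows "card (type_B U) + card (opp U) = card (other U) + 1"
proof -
  have "U \<notin> other U" using same_refl[OF assms] assms other_iff_not_same by blast
  then have "card (type_B U) = Suc (card (other U - opp U))" by (simp add: type_B_def)
  moreover have "card (other U - opp U) + card (opp U) = card (other U)"
    using opp_subset_other by (simp add: card_Diff_subset card_mono)
  ultimately show ?thesis by simp
qed

text \<open>By \<open>card_type_B\<close> it suffices that the degree \<open>D\<close> is at least
  2. A reflected copy of \<open>U\<close> lies in the second class and meets \<open>U\<close>, so
  \<open>D + 1\<close> is at most the class size; \<open>card_other_le\<close> then yields
  \<open>q \<le> 2 * D\<close> with \<open>q = CARD('a)\<close>.\<close>

lemma card_type_B_less_same:
  assumes N: "odd N" "N \<ge> 2" and q: "CARD('a) \<ge> 3" and U: "gen U" and V: "gen V"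
  shows "card (type_B V) < card (same U)"
proof -
  obtain r where r: "F r \<noteq> 0" using ex_nonsingular_reflect U N by fastforce
  have g: "gen (reflect r ` U)" using isometry_gen reflect_isometry r U by blast
  have d: "vec.dim (U \<inter> reflect r ` U) + 1 = N" by (rule dim_gen_Int_reflect[OF r U])
  have "vec.dim (U \<inter> reflect r ` U) \<noteq> 0" using N(2) d by linarith
  moreover have "even (vec.dim (U \<inter> reflect r ` U))" using N(1) by (simp flip: d)
  ultimately have "reflect r ` U \<in> other U - opp U" using g by (auto simp: other_def opp_def)
  then have "opp U \<subset> other U" using opp_subset_other by blast
  then have "card (opp U) + 1 \<le> card (other U)" by (simp add: psubset_card_mono Suc_le_eq)
  then have "CARD('a) * (card (opp U) + 1) \<le> CARD('a) * card (other U)" by (intro mult_left_mono) auto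
  also have "\<dots> \<le> (CARD('a) + 2) * card (opp U)" by (rule card_other_le[OF U N(2) q])
  finally have "card (opp U) \<ge> 2" using q by (simp add: algebra_simps)
  then show ?thesis
    using card_type_B[OF N(1) V] card_same[OF U] card_opp_eq[OF U V] card_other_eq[OF U V] N by simp
qed

text \<open>Two elements in each class allow \<open>card_missed_by_two\<close> to be applied on both
  sides; adding the two bounds and using \<open>card_other_le\<close> bounds \<open>card S\<close>
  by \<open>?K - ?D\<close>, one below the size of type B.\<close>

lemma card_ekr_less_type_B:
  assumes N: "odd N" "N \<ge> 2" and q: "CARD('a) \<ge> 3" and V: "gen V"
    and S: "ekr S" and U: "U \<in> S" "U' \<in> S" "U' \<in> same U" "U \<noteq> U'"
    and W: "W \<in> S" "W' \<in> S" "W \<in> other U" "W' \<in> same W" "W \<noteq> W'"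
  shows "card S < card (type_B V)"
proof -
  let ?q = "CARD('a)" and ?D = "card (opp V)" and ?K = "card (other V)"
  let ?X = "S \<inter> same U" and ?Y = "S \<inter> other U"
  have g: "gen U" "gen W" using S U W by (auto simp: ekr_def)
  have eq: "other W = same U" using same_other(2)[OF N(1) g(1) W(3)] .
  have dis: "S \<inter> opp Z = {}" if "Z \<in> S" for Z using S that by (auto simp: ekr_def opp_def)
  have "(?q + 1) * ?D + ?q * card ?Y \<le> ?q * ?K"
    using card_missed_by_two[OF N(1) g(1) U(3,4), of ?Y] dis[OF U(1)] dis[OF U(2)]
      card_opp_eq[OF g(1) V] card_other_eq[OF g(1) V] by force
  moreover have "(?q + 1) * ?D + ?q * card ?X \<le> ?q * ?K"
    using card_missed_by_two[OF N(1) g(2) W(4,5), of ?X] dis[OF W(1)] dis[OF W(2)]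
      card_opp_eq[OF g(2) V] card_other_eq[OF g(2) V] eq by force
  moreover have "?q * ?K \<le> (?q + 2) * ?D" by (rule card_other_le[OF V N(2) q])
  ultimately have "?q * (card ?X + card ?Y + ?D) \<le> ?q * ?K" by (simp add: algebra_simps)
  then have "card ?X + card ?Y + ?D \<le> ?K" by (simp only: mult_le_cancel1) simp
  moreover have "card S = card ?X + card ?Y"
  proof -
    have "S = ?X \<union> ?Y" using S other_iff_not_same by (auto simp: ekr_def)
    then have "card S = card (?X \<union> ?Y)" by simp
    also have "\<dots> = card ?X + card ?Y"
      by (rule card_Un_disjoint) (auto simp: same_def other_def)
    finally show ?thesis .
  qed
  ultimately show ?thesis using card_type_B[OF N(1) V] by simp
qed

text \<open>If \<open>S\<close> meets both classes and has just one element in one of them, it lies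
  in the type B set of that element.\<close>

lemma ekr_cases:
  assumes N: "odd N" "N \<ge> 2" and q: "CARD('a) \<ge> 3" and S: "ekr S" and V: "gen V"
  shows "(\<exists>U. gen U \<and> S \<subseteq> same U) \<or> (\<exists>U. gen U \<and> S \<subseteq> type_B U) \<or> card S < card (type_B V)"
proof (cases "S \<subseteq> same V \<or> S \<subseteq> other V")
  case True
  obtain r where r: "F r \<noteq> 0" using ex_nonsingular_reflect V N by fastforce
  have "gen (reflect r ` V)" using isometry_gen reflect_isometry r V by blast
  moreover have "same (reflect r ` V) = other V"
    using even_dim_Int_reflect[OF r V] by (auto simp: other_def same_def Int_commute)
  ultimately show ?thesis using True V by metis
next
  case False
  have gen: "gen X" if "X \<in> S" for X using S that by (simp add: ekr_def)
  obtain U W where U: "U \<in> S" "U \<in> same V" and W: "W \<in> S" "W \<in> other V"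
    using False gen other_iff_not_same by blast
  have same: "same U = same V" "other U = other V" using same_eq[OF N(1) V U(2)] by auto
  have other: "same W = other V" "other W = same V" using same_other[OF N(1) V W(2)] by auto
  have split: "X \<in> same V \<or> X \<in> other V" if "X \<in> S" for X
    using gen[OF that] other_iff_not_same by blast
  have dis: "X \<notin> opp Y" if "X \<in> S" "Y \<in> S" for X Y using S that by (auto simp: ekr_def opp_def)
  show ?thesis
  proof (cases "\<exists>U'\<in>S. U' \<in> same U \<and> U' \<noteq> U")
    case nU: False
    have "S \<subseteq> type_B U" using split dis U(1) nU same by (auto simp: type_B_def)
    then show ?thesis using gen U by blast
  next
    case U': True
    show ?thesis
    proof (cases "\<exists>W'\<in>S. W' \<in> same W \<and> W' \<noteq> W")
      case nW: False
      have "S \<subseteq> type_B W" using split dis W(1) nW other by (auto simp: type_B_def)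
      then show ?thesis using gen W by blast
    next
      case True
      then show ?thesis
        using U' card_ekr_less_type_B[OF N q V S U(1) _ _ _ W(1)] W(2) same by metis
    qed
  qed
qed

end

section \<open>From the coordinate definition of the quadric to its quadratic form\<close>

lemma invertible_matrix_vector:
  fixes M :: "'a::field ^ 'd ^ 'd"
  assumes "invertible M"
  obtains M' where "\<And>x. M *v (M' *v x) = x" "\<And>x. M' *v (M *v x) = x"
proof -
  obtain M' where "M ** M' = mat 1" "M' ** M = mat 1" using assms invertible_def by blast
  then show ?thesis using that[of M'] by (simp add: matrix_vector_mul_assoc)
qed

lemma hyperbolic_quadric_form:
  fixes Q :: "('a::{field,finite} ^ 'd) set set"
  assumes "hyperbolic_quadric m Q"
  obtains F B where "hyperbolic_form F B (m + 1)" "Q = {P \<in> points_of UNIV. \<forall>x\<in>P. F x = 0}"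
proof -
  obtain M :: "'a ^ 'd ^ 'd" and e :: "nat \<Rightarrow> 'd"
    where M: "invertible M" and e: "bij_betw e {..<2 * m + 2} UNIV"
      and Q: "Q = {P \<in> points_of UNIV.
               \<forall>x\<in>P. (\<Sum>i\<le>m. (M *v x) $ e (2 * i) * (M *v x) $ e (2 * i + 1)) = 0}"
    using assms by (auto simp: hyperbolic_quadric_def)
  obtain M' where M': "\<And>x. M *v (M' *v x) = x" "\<And>x. M' *v (M *v x) = x"
    using invertible_matrix_vector[OF M] by blast
  define F where "F x = (\<Sum>i\<le>m. (M *v x) $ e (2 * i) * (M *v x) $ e (2 * i + 1))" for x
  define B where "B x y = (\<Sum>i\<le>m. (M *v x) $ e (2 * i) * (M *v y) $ e (2 * i + 1) +
      (M *v x) $ e (2 * i + 1) * (M *v y) $ e (2 * i))" for x y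
  have inj: "e i = e j \<longleftrightarrow> i = j" if "i < 2 * m + 2" "j < 2 * m + 2" for i j
    using e that by (auto simp: bij_betw_def dest: inj_onD)
  have card: "CARD('d) = 2 * (m + 1)" using bij_betw_same_card[OF e] by simp
  have "hyperbolic_form F B (m + 1)"
  proof
    show "CARD('d) = 2 * (m + 1)" by (rule card)
    fix x y z :: "'a ^ 'd" and c
    show "F (x + y) = F x + F y + B x y"
      by (simp add: F_def B_def matrix_vector_right_distrib sum.distrib[symmetric] algebra_simps)
    show "F (c *s x) = c * c * F x"
      by (simp add: F_def sum_distrib_left vec.scale algebra_simps)
    show "B (x + y) z = B x z + B y z"
      by (simp add: B_def matrix_vector_right_distrib sum.distrib[symmetric] algebra_simps)
    show "B (c *s x) z = c * B x z"
      by (simp add: B_def sum_distrib_left vec.scale algebra_simps)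
  next
    fix x :: "'a ^ 'd" assume B0: "\<And>y. B x y = 0"
    \<comment> \<open>Coordinates are paired as \<open>2 * i\<close> and \<open>2 * i + 1\<close>.
      Testing \<open>B x\<close> on the preimage of the unit vector of the partner coordinate
      isolates coordinate \<open>j\<close>.\<close>
    have "(M *v x) $ j = 0" for j
    proof -
      have "j \<in> e ` {..<2 * m + 2}" using e by (simp add: bij_betw_def)
      then obtain k where k: "j = e k" "k < 2 * m + 2" by auto
      define i where "i = k div 2"
      have i: "i \<le> m" using k by (simp add: i_def)
      show ?thesis
      proof (cases "even k")
        case True
        then have "k = 2 * i" by (simp add: i_def)
        moreover have "B x (M' *v axis (e (2 * i + 1)) 1) = (M *v x) $ e (2 * i)"
        proof -
          have "B x (M' *v axis (e (2 * i + 1)) 1) = (\<Sum>l\<le>m. if l = i then (M *v x) $ e (2 * l) else 0)"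
            unfolding B_def M'(1) using i by (intro sum.cong) (auto simp: axis_def inj, presburger?)
          then show ?thesis using i by simp
        qed
        ultimately show ?thesis using B0 k by simp
      next
        case False
        then have "k = 2 * i + 1" by (simp add: i_def)
        moreover have "B x (M' *v axis (e (2 * i)) 1) = (M *v x) $ e (2 * i + 1)"
        proof -
          have "B x (M' *v axis (e (2 * i)) 1) = (\<Sum>l\<le>m. if l = i then (M *v x) $ e (2 * l + 1) else 0)"
            unfolding B_def M'(1) using i by (intro sum.cong) (auto simp: axis_def inj, presburger?)
          then show ?thesis using i by simp
        qed
        ultimately show ?thesis using B0 k by simp
      qed
    qed
    then have "M *v x = 0" by (simp add: vec_eq_iff)
    then show "x = 0" using M'(2)[of x] by simp
  next
    \<comment> \<open>Vectors supported on the even-numbered coordinates have a zero factor in every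
      product of the equation.\<close>
    let ?I = "(\<lambda>i. e (2 * i)) ` {..m}"
    let ?W = "{y :: 'a ^ 'd. \<forall>i. i \<notin> ?I \<longrightarrow> y $ i = 0}"
    have "card ?I = m + 1" by (subst card_image) (auto intro!: inj_onI simp: inj)
    then have dW: "vec.dim ?W = m + 1" by (simp only: dim_substandard_cart)
    have sW: "vec.subspace ?W" by (auto simp: vec.subspace_def)
    have "inj ((*v) M')" using M' by (metis injI)
    then have "vec.dim ((*v) M' ` ?W) = vec.dim ?W"
      by (intro vec.dim_image_eq[OF matrix_vector_mul_linear_gen]) (auto intro: inj_on_subset)
    moreover have "vec.subspace ((*v) M' ` ?W)"
      using vec.linear_subspace_image[OF matrix_vector_mul_linear_gen] sW by blast
    moreover have "F (M' *v y) = 0" if "y \<in> ?W" for y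
    proof -
      have "y $ e (2 * i + 1) = 0" if "i \<le> m" for i
      proof -
        have "e (2 * i + 1) \<notin> ?I"
        proof
          assume "e (2 * i + 1) \<in> ?I"
          then obtain l where "l \<le> m" "e (2 * i + 1) = e (2 * l)" by auto
          then have "2 * i + 1 = 2 * l" using inj[of "2 * i + 1" "2 * l"] that by simp
          then show False by presburger
        qed
        then show ?thesis using \<open>y \<in> ?W\<close> by blast
      qed
      then show ?thesis by (simp add: F_def M'(1))
    qed
    ultimately show "\<exists>U. vec.subspace U \<and> (\<forall>x\<in>U. F x = 0) \<and> vec.dim U = m + 1"
      using dW by (intro exI[of _ "(*v) M' ` ?W"]) auto
  qed
  moreover have "Q = {P \<in> points_of UNIV. \<forall>x\<in>P. F x = 0}" using Q by (simp add: F_def)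
  ultimately show ?thesis by (rule that)
qed

lemma span_singleton_point:
  assumes "vec.subspace U" "x \<in> U" "x \<noteq> 0"
  shows "vec.span {x} \<in> points_of U"
  using assms vec.span_minimal[of "{x}" U] by (simp add: points_of_def proj_dim_def)

lemma points_of_nonempty:
  assumes U: "vec.subspace U"
  shows "points_of U \<noteq> {} \<longleftrightarrow> U \<noteq> {0}"
proof
  assume "points_of U \<noteq> {}"
  then obtain P where P: "vec.dim P = 1" "P \<subseteq> U" by (auto simp: points_of_def proj_dim_def)
  then have "\<not> P \<subseteq> {0}" by (metis vec.dim_eq_0 zero_neq_one)
  then show "U \<noteq> {0}" using P by blast
next
  assume "U \<noteq> {0}"
  then show "points_of U \<noteq> {}" using span_singleton_point[OF U] vec_subspace_nonzero[OF U] by blast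
qed

lemma subspaces_on_zeros:
  assumes Q: "Q = {P \<in> points_of UNIV. \<forall>x\<in>P. F x = 0}" and "F 0 = 0"
  shows "U \<in> subspaces_on Q \<longleftrightarrow> vec.subspace U \<and> (\<forall>x\<in>U. F x = 0)"
proof
  assume U: "U \<in> subspaces_on Q"
  have "F x = 0" if x: "x \<in> U" for x
  proof (cases "x = 0")
    case False
    then have "vec.span {x} \<in> Q"
      using U x span_singleton_point by (auto simp: subspaces_on_def)
    then show ?thesis using Q vec.span_base[of x "{x}"] by blast
  qed (use assms in simp)
  then show "vec.subspace U \<and> (\<forall>x\<in>U. F x = 0)" using U by (simp add: subspaces_on_def)
qed (auto simp: subspaces_on_def points_of_def Q)

section \<open>Translation of generators, classes and Erdos-Ko-Rado sets into the language of
  forms\<close>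

context hyperbolic_form
begin

context
  fixes n :: nat and Q :: "('a ^ 'd) set set"
  assumes odd_N: "odd N" and Q: "Q = {P \<in> points_of UNIV. \<forall>x\<in>P. F x = 0}"
begin

text \<open>Both directions rest on \<open>ex_gen_superset\<close>: every totally singular subspace
  extends to one of dimension \<open>N\<close>.\<close>

lemma generators_iff: "U \<in> generators Q \<longleftrightarrow> gen U"
proof -
  note sub = subspaces_on_zeros[OF Q F_zero]
  show ?thesis
  proof
    assume U: "U \<in> generators Q"
    then obtain G where "gen G" "U \<subseteq> G"
      using ex_gen_superset[of U] sub by (auto simp: generators_def)
    moreover then have "G \<in> subspaces_on Q" using sub by (simp add: gen_def)
    ultimately show "gen U" using U by (auto simp: generators_def)
  next
    assume U: "gen U"
    have "W = U" if W: "W \<in> subspaces_on Q" "U \<subseteq> W" for W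
    proof -
      obtain G where G: "gen G" "W \<subseteq> G" using ex_gen_superset[of W] sub W by auto
      then have "U = G" using vec.subspace_dim_equal[of U G] U W by (auto simp: gen_def)
      then show ?thesis using G W by blast
    qed
    then show "U \<in> generators Q" using U sub by (auto simp: generators_def gen_def)
  qed
qed

lemma meets_iff: "gen U \<Longrightarrow> gen W \<Longrightarrow> meets U W \<longleftrightarrow> U \<inter> W \<noteq> {0}"
  unfolding meets_def by (intro points_of_nonempty vec.subspace_inter gen_subspace)

lemma generator_rel_image:
  assumes "gen U"
  shows "generator_rel (2 * n) Q `` {U} = same U"
proof -
  \<comment> \<open>The shift by one passes from vector to projective dimension. Disjoint
    generators, with \<open>k = 0\<close>, are covered since \<open>-1 mod 2\<close> is 1.\<close>
  have "(int k - 1) mod 2 = int (2 * n) mod 2 \<longleftrightarrow> odd k" for k by simp presburger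
  then show ?thesis using assms by (auto simp: generator_rel_def same_def generators_iff proj_dim_def)
qed

lemma type_A_eq: "EKR_type_A (2 * n) Q = {same U | U. gen U}"
  by (auto simp: EKR_type_A_def generator_classes_def quotient_def generators_iff generator_rel_image)

text \<open>A class that contains \<open>W\<close> but not \<open>U\<close> must be
  \<open>same W\<close>, and then \<open>W\<close> lies in \<open>other U\<close>.\<close>

lemma type_B_eq: "EKR_type_B (2 * n) Q = {type_B U | U. gen U}"
proof -
  have "{W. \<exists>C\<in>generator_classes (2 * n) Q. U \<notin> C \<and> W \<in> C \<and> meets W U} = other U - opp U"
    if U: "gen U" for U
  proof (intro set_eqI iffI)
    fix W assume "W \<in> {W. \<exists>C\<in>generator_classes (2 * n) Q. U \<notin> C \<and> W \<in> C \<and> meets W U}"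
    then obtain V where V: "gen V" "U \<notin> same V" "W \<in> same V" and m: "meets W U"
      using type_A_eq by (auto simp: EKR_type_A_def)
    then have W: "gen W" "same W = same V" using same_eq(1)[OF odd_N V(1,3)] V(3) by (simp_all add: same_def)
    then have "U \<in> other W" using V U other_iff_not_same by simp
    then show "W \<in> other U - opp U"
      using m meets_iff[OF W(1) U] W by (auto simp: other_def opp_def Int_commute)
  next
    fix W assume W: "W \<in> other U - opp U"
    then have g: "gen W" by (simp add: other_def)
    have "same W \<in> generator_classes (2 * n) Q" using type_A_eq g by (auto simp: EKR_type_A_def)
    moreover have "U \<notin> same W" using W by (simp add: other_def same_def Int_commute)
    moreover have "W \<in> same W" by (rule same_refl[OF odd_N g])
    moreover have "meets W U" using meets_iff[OF g U] W g by (auto simp: opp_def Int_commute)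
    ultimately show "W \<in> {W. \<exists>C\<in>generator_classes (2 * n) Q. U \<notin> C \<and> W \<in> C \<and> meets W U}" by blast
  qed
  then show ?thesis
    by (auto simp: EKR_type_B_def generators_iff type_B_def)
qed

lemma EKR_set_iff: "EKR_set Q S \<longleftrightarrow> ekr S"
  unfolding EKR_set_def ekr_def using generators_iff meets_iff by (metis subset_iff)

end

end

theorem theorem3p7:
  fixes n q :: nat and Q :: "('a::{field,finite} ^ 'd) set set"
  assumes "n \<ge> 1" and "q \<ge> 3"
    and "CARD('a) = q" and "CARD('d) = 4 * n + 2"
    and "hyperbolic_quadric (2 * n) Q"
  shows "(\<forall>S \<in> EKR_type_A (2 * n) Q \<union> EKR_type_B (2 * n) Q. maximal_EKR_set Q S) \<and>
         (\<forall>A \<in> EKR_type_A (2 * n) Q. \<forall>B \<in> EKR_type_B (2 * n) Q. card B < card A) \<and>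
         (\<forall>S. maximal_EKR_set Q S \<and> S \<notin> EKR_type_A (2 * n) Q \<and> S \<notin> EKR_type_B (2 * n) Q \<longrightarrow>
              (\<forall>B \<in> EKR_type_B (2 * n) Q. card S < card B))"
proof -
  obtain F B where form: "hyperbolic_form F B (2 * n + 1)"
    and Q: "Q = {P \<in> points_of UNIV. \<forall>x\<in>P. F x = 0}"
    using hyperbolic_quadric_form[OF assms(5)] .
  interpret hyperbolic_form F B "2 * n + 1" by (rule form)
  have N: "odd (2 * n + 1)" "2 * n + 1 \<ge> 2" and q: "CARD('a) \<ge> 3" using assms by simp_all
  note A = type_A_eq[OF N(1) Q] and B = type_B_eq[OF N(1) Q] and ekr = EKR_set_iff[OF N(1) Q]
  have max_A: "maximal_EKR_set Q (same U)" if "gen U" for U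
    using ekr_same[OF N(1) that] same_maximal[OF N(1) that] by (auto simp: maximal_EKR_set_def ekr)
  have max_B: "maximal_EKR_set Q (type_B U)" if "gen U" for U
    using ekr_type_B[OF N(1) that] type_B_maximal[OF N(1) that] by (auto simp: maximal_EKR_set_def ekr)
  have "card S < card (type_B V)"
    if S: "maximal_EKR_set Q S" "S \<notin> EKR_type_A (2 * n) Q" "S \<notin> EKR_type_B (2 * n) Q" and V: "gen V" for S V
  proof -
    \<comment> \<open>By maximality, containment in a set of type A or B would be equality, so only
      the size bound of \<open>ekr_cases\<close> remains.\<close>
    have "ekr S" and eq: "\<And>T. ekr T \<Longrightarrow> S \<subseteq> T \<Longrightarrow> S = T"
      using S(1) unfolding maximal_EKR_set_def ekr by blast+
    have "\<not> S \<subseteq> same U" if "gen U" for U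
    proof
      assume "S \<subseteq> same U"
      then have "S = same U" by (rule eq[OF ekr_same[OF N(1) that]])
      then show False using S(2) that unfolding A by blast
    qed
    moreover have "\<not> S \<subseteq> type_B U" if "gen U" for U
    proof
      assume "S \<subseteq> type_B U"
      then have "S = type_B U" by (rule eq[OF ekr_type_B[OF N(1) that]])
      then show False using S(3) that unfolding B by blast
    qed
    ultimately show ?thesis using ekr_cases[OF N q \<open>ekr S\<close> V] by blast
  qed
  moreover have "card (type_B V) < card (same U)" if "gen U" "gen V" for U V
    using card_type_B_less_same[OF N q that] .
  ultimately show ?thesis unfolding A B using max_A max_B by blast
qed

end
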